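(* Let $A,B,V,W\in M_m(\mathbb R)$. The two systems of second-order differential equations $$\ddot x(t)+A\dot x(t)+Bx(t)=0,\qquad \ddot\xi(t)+V\dot\xi(t)+W\xi(t)=0$$ are $L$-equivalent if and only if there exists a nonsingular matrix $C\in M_m(\mathbb R)$ satisfying the conditions $$V_R=C^{-1}A_RC,$$ $$4W=V^2+C^{-1}(4B-A^2)C,$$ $$\left\{(4B-A^2)A^{(n)}(CVC^{-1}-A)\right\}=0,\qquad n=0,1,\ldots,m^2-1.$$
   Context: $M_m(\mathbb R)$ is the space of real $m\times m$ matrices. Iterated commutators: $[X,Y]=XY-YX$; $\{A_1\}=A_1$, $\{A_1A_2\}=[A_1,A_2]$ and $\{A_1A_2\ldots A_n\}=[\{A_1\ldots A_{n-1}\},A_n]$. The symbol $A^{(n)}$ inside braces means that $A$ is repeated $n$ times; thus $\{ZA^{(0)}\}=Z$, $\{ZA^{(n)}\}=[\{ZA^{(n-1)}\},A]$, and $\{ZA^{(n)}X\}=[\{ZA^{(n)}\},X]$. Real part $A_R$: for $A\in M_m(\mathbb R)$ write the Jordan form $A=T\,\mathrm{diag}[\lambda_1E^{(p_1)}+H^{(p_1)},\ldots,\lambda_rE^{(p_r)}+H^{(p_r)}]\,T^{-1}$ with $T$ a nonsingular complex matrix, $\lambda_k=\alpha_k+i\beta_k$ ($\alpha_k,\beta_k\in\mathbb R$), $E^{(p)}$ the $p\times p$ identity, and $H^{(p)}$ the $p\times p$ matrix with ones on the first superdiagonal and zeros elsewhere. Then $A_R=T\,\mathrm{diag}[\alpha_1E^{(p_1)}+H^{(p_1)},\ldots,\alpha_rE^{(p_r)}+H^{(p_r)}]\,T^{-1}$,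 which is a real matrix. $V_R$ is defined in the same way from $V$. A matrix function $L(t)$ with real $C^1$ entries is regular on $[0,+\infty)$ if there is $\eta>0$ with $|\det L(t)|>\eta$ for all $t\ge0$ and $\sup_{t\ge0}\|L(t)\|<+\infty$. The system $\ddot x+A\dot x+Bx=0$ is $L$-equivalent to $\ddot\xi+V\dot\xi+W\xi=0$ if there exists a regular on $[0,+\infty)$ matrix $L(t)$ such that for all $t\ge 0$ $$V=L^{-1}(t)(2\dot L(t)+AL(t)),\qquad W=L^{-1}(t)(\ddot L(t)+A\dot L(t)+BL(t)).$$ *)

theory Defs
  imports
    "Jordan_Normal_Form.Jordan_Normal_Form_Existence"
    "Jordan_Normal_Form.Gauss_Jordan_Elimination"
begin

definition commutator :: "'a :: comm_ring_1 mat \<Rightarrow> 'a mat \<Rightarrow> 'a mat" where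
  "commutator X Y = X * Y - Y * X"

text \<open>\<open>iterated_commutator A\<^sub>1 [A\<^sub>2, \<dots>, A\<^sub>n]\<close> is \<open>{A\<^sub>1 A\<^sub>2 \<dots> A\<^sub>n}\<close>; in particular
  \<open>{Z A\<^sup>(\<^sup>n\<^sup>) X}\<close> is \<open>iterated_commutator Z (replicate n A @ [X])\<close>.\<close>

definition iterated_commutator :: "'a :: comm_ring_1 mat \<Rightarrow> 'a mat list \<Rightarrow> 'a mat" where
  "iterated_commutator A\<^sub>1 As = foldl commutator A\<^sub>1 As"

text \<open>Only meaningful for nonsingular square matrices.\<close>

definition mat_inv :: "'a :: field mat \<Rightarrow> 'a mat" where
  "mat_inv A = the (mat_inverse A)"

lemma mat_inv:
  fixes A :: "'a :: field mat"
  assumes A: "A \<in> carrier_mat n n" and inv: "invertible_mat A"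
  shows "mat_inv A \<in> carrier_mat n n"
    and "A * mat_inv A = 1\<^sub>m n"
    and "mat_inv A * A = 1\<^sub>m n"
proof -
  from inv obtain B where B: "A * B = 1\<^sub>m (dim_row A)" "B * A = 1\<^sub>m (dim_row B)"
    unfolding invertible_mat_def inverts_mat_def by auto
  from A B(1) have c: "dim_col B = n" by (metis carrier_matD(1) index_mult_mat(3) index_one_mat(3))
  from A B(2) have r: "dim_row B = n" by (metis carrier_matD(2) index_mult_mat(3) index_one_mat(3))
  have "A \<in> Units (ring_mat TYPE('a) n ())"
    using A B c r unfolding Units_def ring_mat_def by auto
  then obtain C where "mat_inverse A = Some C"
    using mat_inverse(1)[OF A, where b = "()"] by (cases "mat_inverse A") auto
  with mat_inverse(2)[OF A this]
  show "mat_inv A \<in> carrier_mat n n" "A * mat_inv A = 1\<^sub>m n" "mat_inv A * A = 1\<^sub>m n"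
    by (auto simp: mat_inv_def)
qed

text \<open>\<open>R\<close> arises from a complex Jordan form \<open>A = T J T\<^sup>-\<^sup>1\<close> by replacing each eigenvalue in \<open>J\<close>
  by its real part, keeping \<open>T\<close> and the block structure. The list \<open>bs\<close> holds the pairs
  \<open>(p\<^sub>k, \<lambda>\<^sub>k)\<close>, and \<open>S\<close> is the inverse of \<open>T\<close>.\<close>

definition is_real_part_mat :: "real mat \<Rightarrow> real mat \<Rightarrow> bool" where
  "is_real_part_mat A R \<longleftrightarrow> (\<exists>T S bs. 0 \<notin> fst ` set bs \<and>
     similar_mat_wit (map_mat complex_of_real A) (jordan_matrix bs) T S \<and>
     similar_mat_wit (map_mat complex_of_real R)
       (jordan_matrix (map (\<lambda>(p, l). (p, complex_of_real (Re l))) bs)) T S)"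

text \<open>Such an \<open>R\<close> exists and does not depend on the chosen Jordan form: it is the sum of the nilpotent
  part of \<open>A\<close> and of the polynomial in the semisimple part of \<open>A\<close> which maps each eigenvalue to its
  real part. Hence the definite description is proper for every square \<open>A\<close>.\<close>

definition real_part_mat :: "real mat \<Rightarrow> real mat" where
  "real_part_mat A = (THE R. is_real_part_mat A R)"

text \<open>Entrywise derivative on \<open>[0, \<infinity>)\<close>, one-sided at \<open>0\<close>.\<close>

definition has_mat_deriv :: "nat \<Rightarrow> (real \<Rightarrow> real mat) \<Rightarrow> (real \<Rightarrow> real mat) \<Rightarrow> bool" where
  "has_mat_deriv m L L' \<longleftrightarrow> (\<forall>t\<ge>0. L t \<in> carrier_mat m m \<and> L' t \<in> carrier_mat m m \<and>
     (\<forall>i<m. \<forall>j<m. ((\<lambda>s. L s $$ (i, j)) has_real_derivative L' t $$ (i, j)) (at t within {0..})))"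

text \<open>Boundedness is expressed with the entrywise maximum norm; all norms on the space of
  \<open>m \<times> m\<close> matrices are equivalent.\<close>

definition regular_mat_fun :: "nat \<Rightarrow> (real \<Rightarrow> real mat) \<Rightarrow> bool" where
  "regular_mat_fun m L \<longleftrightarrow>
     (\<exists>L'. has_mat_deriv m L L' \<and> (\<forall>i<m. \<forall>j<m. continuous_on {0..} (\<lambda>t. L' t $$ (i, j)))) \<and>
     (\<exists>\<eta>>0. \<forall>t\<ge>0. \<bar>det (L t)\<bar> > \<eta>) \<and>
     (\<exists>K. \<forall>t\<ge>0. norm_bound (L t) K)"

text \<open>\<open>L\<close>-equivalence of \<open>x'' + A x' + B x = 0\<close> and \<open>\<xi>'' + V \<xi>' + W \<xi> = 0\<close>. The second derivative
  of \<open>L\<close> is not part of regularity; its existence is implicit in the condition on \<open>W\<close>.\<close>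

definition L_equivalent ::
  "nat \<Rightarrow> real mat \<Rightarrow> real mat \<Rightarrow> real mat \<Rightarrow> real mat \<Rightarrow> bool" where
  "L_equivalent m A B V W \<longleftrightarrow> (\<exists>L L' L''. regular_mat_fun m L \<and>
     has_mat_deriv m L L' \<and> has_mat_deriv m L' L'' \<and>
     (\<forall>t\<ge>0. V = mat_inv (L t) * (2 \<cdot>\<^sub>m L' t + A * L t) \<and>
             W = mat_inv (L t) * (L'' t + A * L' t + B * L t)))"

end

theory Submission
  imports Defs
begin

text \<open>Put \<open>\<Phi> X = (X V - A X) / 2\<close>, \<open>Q = 4 B - A\<^sup>2\<close> and \<open>G = 4 W - V\<^sup>2\<close>. The two equations defining
  \<open>L\<close>-equivalence say that \<open>L' = \<Phi> L\<close> and \<open>L G = Q L\<close>. Differentiating the latter repeatedly shows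
  that it propagates to \<open>L {G V\<^sup>(\<^sup>n\<^sup>)} = {Q A\<^sup>(\<^sup>n\<^sup>)} L\<close> for all \<open>n\<close>; conversely, if these identities hold at
  \<open>t = 0\<close>, all derivatives of \<open>L G - Q L\<close> vanish there, so that \<open>L G = Q L\<close> by Taylor's theorem. For an
  invertible \<open>C\<close> with \<open>C G = Q C\<close> the identities for all \<open>n\<close> amount to the commutator conditions, of
  which \<open>m\<^sup>2\<close> suffice by linear dependence.

  Boundedness brings in the real parts. In Jordan coordinates, multiplying the entries by suitable
  unimodular exponentials replaces the eigenvalues by their real parts, and a bounded solution of the
  resulting real triangular system has a derivative tending to zero. Hence \<open>A\<^sub>R L - L V\<^sub>R\<close> tends to zero, and
  \<open>C\<close> can be taken as a limit point of \<open>L\<close> at infinity. Conversely, if \<open>A\<^sub>R C = C V\<^sub>R\<close>, the solution of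
  \<open>L' = \<Phi> L\<close> through \<open>C\<close> is \<open>C\<close> with its entries in Jordan coordinates multiplied by unimodular
  exponentials, so it is bounded with \<open>\<bar>det L\<bar> = \<bar>det C\<bar>\<close>.\<close>

subsection \<open>Scalar differential equations on a half-line\<close>

text \<open>By the mean value theorem a bounded \<open>y\<close> forces its derivative
  \<open>z\<close> to be small somewhere in any long enough window, and since the derivative
  \<open>g\<close> of \<open>z\<close> is small, \<open>z\<close> cannot move far across that
  window.\<close>

lemma derivative_tendsto_0_of_bounded:
  fixes y z g :: "real \<Rightarrow> real"
  assumes y: "\<And>t. t > 0 \<Longrightarrow> (y has_real_derivative z t) (at t)"
    and z: "\<And>t. t > 0 \<Longrightarrow> (z has_real_derivative g t) (at t)"
    and K: "\<And>t. t > 0 \<Longrightarrow> \<bar>y t\<bar> \<le> K"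
    and g: "(g \<longlongrightarrow> 0) at_top"
  shows "(z \<longlongrightarrow> 0) at_top"
proof (rule tendstoI)
  fix e :: real assume e: "e > 0"
  have K0: "K \<ge> 0" using K[of 1] by auto
  \<comment> \<open>The window length balances two errors: \<open>2 * K / h\<close> stays below
    \<open>e / 2\<close>, while \<open>\<bar>g\<bar> < e / (4 * h)\<close> limits the drift of
    \<open>z\<close> over the window to \<open>e / 4\<close>.\<close>
  define h where "h = 4 * (K + 1) / e"
  have h: "h > 0" using e K0 by (simp add: h_def)
  have "e / (4 * h) > 0" using e h by simp
  from tendstoD[OF g this] obtain T where T: "\<And>t. t \<ge> T \<Longrightarrow> \<bar>g t\<bar> < e / (4 * h)"
    by (auto simp: eventually_at_top_linorder)
  have "\<bar>z t\<bar> < e" if t: "t \<ge> max T 1" for t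
  proof -
    have "\<exists>\<xi>>t. \<xi> < t + h \<and> y (t + h) - y t = (t + h - t) * z \<xi>"
      by (rule MVT2) (use h t y in auto)
    then obtain u where u: "t < u" "u < t + h" "y (t + h) - y t = h * z u" by auto
    have "\<exists>\<xi>>t. \<xi> < u \<and> z u - z t = (u - t) * g \<xi>"
      by (rule MVT2) (use u(1) t z in auto)
    then obtain v where v: "t < v" "v < u" "z u - z t = (u - t) * g v" by auto
    have "h * \<bar>z u\<bar> = \<bar>y (t + h) - y t\<bar>" using u(3) h by (simp add: abs_mult)
    also have "\<dots> \<le> 2 * K" using K[of t] K[of "t + h"] t h by auto
    finally have "\<bar>z u\<bar> \<le> 2 * K / h" using h by (simp add: field_simps)
    also have "2 * K / h \<le> e / 2" using e K0 by (simp add: h_def field_simps)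
    finally have 1: "\<bar>z u\<bar> \<le> e / 2" .
    have "\<bar>z u - z t\<bar> = (u - t) * \<bar>g v\<bar>" using v u by (simp add: abs_mult)
    also have "\<dots> \<le> h * (e / (4 * h))"
      using u v t T[of v] h by (intro mult_mono) auto
    also have "\<dots> = e / 4" using h by simp
    finally show ?thesis using 1 e by linarith
  qed
  then show "\<forall>\<^sub>F t in at_top. dist (z t) 0 < e"
    by (auto simp: eventually_at_top_linorder intro!: exI[of _ "max T 1"])
qed

text \<open>For \<open>c > 0\<close> the homogeneous equation is unstable, so a bounded solution is
  controlled from infinity: \<open>(z + e) exp (- c t)\<close> is nonincreasing from
  \<open>T\<close> on and tends to 0, hence is nonnegative.\<close>

lemma linear_ode_bounded_lower_bound:
  fixes z g :: "real \<Rightarrow> real"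
  assumes z: "\<And>t. t > 0 \<Longrightarrow> (z has_real_derivative c * z t + g t) (at t)"
    and M: "\<And>t. t > 0 \<Longrightarrow> \<bar>z t\<bar> \<le> M"
    and c: "c > 0" and T: "T > 0" "\<And>t. t \<ge> T \<Longrightarrow> g t \<le> c * e" and t: "t \<ge> T"
  shows "- e \<le> z t"
proof -
  define w where "w s = (z s + e) * exp (- c * s)" for s
  have w: "(w has_real_derivative (g s - c * e) * exp (- c * s)) (at s)" if "s > 0" for s
    unfolding w_def by (rule derivative_eq_intros z that refl | simp add: algebra_simps)+
  have mono: "w s \<le> w t" if s: "s \<ge> t" for s
  proof (rule DERIV_nonpos_imp_nonincreasing[OF s])
    fix x assume x: "t \<le> x" "x \<le> s"
    have "(g x - c * e) * exp (- c * x) \<le> 0"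
      using T(2)[of x] x t by (intro mult_nonpos_nonneg) auto
    with w[of x] x t T show "\<exists>d. (w has_real_derivative d) (at x) \<and> d \<le> 0"
      by (intro exI[of _ "(g x - c * e) * exp (- c * x)"]) auto
  qed
  have exp0: "((\<lambda>s. exp (- c * s)) \<longlongrightarrow> 0) at_top"
    using c by (intro filterlim_compose[OF exp_at_bot] filterlim_tendsto_neg_mult_at_bot[OF tendsto_const] filterlim_ident) auto
  have "\<forall>\<^sub>F s in at_top. norm (w s) \<le> norm (exp (- c * s)) * (M + \<bar>e\<bar>)"
    unfolding eventually_at_top_linorder
  proof (intro exI[of _ 1] allI impI)
    fix s :: real assume "1 \<le> s"
    then have "\<bar>z s + e\<bar> \<le> M + \<bar>e\<bar>" using M[of s] by linarith
    then show "norm (w s) \<le> norm (exp (- c * s)) * (M + \<bar>e\<bar>)"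
      by (simp add: w_def abs_mult mult.commute)
  qed
  from tendsto_0_le[OF exp0 this] have "(w \<longlongrightarrow> 0) at_top" .
  then have "0 \<le> w t"
    by (rule tendsto_upperbound) (use mono in \<open>auto simp: eventually_at_top_linorder\<close>)
  then show ?thesis by (simp add: w_def zero_le_mult_iff)
qed

text \<open>For \<open>c > 0\<close> the one-sided bound applies to both \<open>z\<close> and
  \<open>- z\<close>. For \<open>c < 0\<close> the integrating factor tends to infinity, and
  l'Hospital's rule reduces the limit of \<open>z\<close> to that of
  \<open>g / (- c)\<close>.\<close>

lemma linear_ode_bounded_tendsto_0:
  fixes z g :: "real \<Rightarrow> real"
  assumes z: "\<And>t. t > 0 \<Longrightarrow> (z has_real_derivative c * z t + g t) (at t)"
    and M: "\<And>t. t > 0 \<Longrightarrow> \<bar>z t\<bar> \<le> M"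
    and g: "(g \<longlongrightarrow> 0) at_top" and c: "c \<noteq> 0"
  shows "(z \<longlongrightarrow> 0) at_top"
proof (cases "c > 0")
  case True
  show ?thesis
  proof (rule tendstoI)
    fix e :: real assume e: "e > 0"
    have "c * (e / 2) > 0" using True e by simp
    from tendstoD[OF g this] obtain T where T: "\<And>t. t \<ge> T \<Longrightarrow> \<bar>g t\<bar> < c * (e / 2)"
      by (auto simp: eventually_at_top_linorder)
    have gT: "g s \<le> c * (e / 2)" "- g s \<le> c * (e / 2)" if "s \<ge> max T 1" for s
      using T[of s] that by (simp_all only: max.bounded_iff abs_less_iff, linarith+)
    have "\<bar>z t\<bar> < e" if t: "t \<ge> max T 1" for t
    proof -
      have "- (e / 2) \<le> z t"
        by (rule linear_ode_bounded_lower_bound[OF z M True _ gT(1) t]) auto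
      moreover have "- (e / 2) \<le> - z t"
      proof (rule linear_ode_bounded_lower_bound[of "\<lambda>t. - z t" c "\<lambda>t. - g t" M, OF _ _ True _ gT(2) t])
        show "((\<lambda>t. - z t) has_real_derivative c * - z s + - g s) (at s)" if "s > 0" for s
          by (rule derivative_eq_intros z that | simp)+
      qed (use M in auto)
      ultimately show ?thesis using e by linarith
    qed
    then show "\<forall>\<^sub>F t in at_top. dist (z t) 0 < e"
      by (auto simp: eventually_at_top_linorder intro!: exI[of _ "max T 1"])
  qed
next
  case False
  with c have c: "c < 0" by simp
  have "((\<lambda>t. z t * exp (- c * t) / exp (- c * t)) \<longlongrightarrow> 0) at_top"
  proof (rule lhospital_at_top_at_top[of "\<lambda>t. exp (- c * t)" "\<lambda>t. - c * exp (- c * t)" _ "\<lambda>t. g t * exp (- c * t)"])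
    show "filterlim (\<lambda>t. exp (- c * t)) at_top at_top"
      using c by (intro filterlim_compose[OF exp_at_top] filterlim_tendsto_pos_mult_at_top[OF tendsto_const] filterlim_ident) auto
    show "\<forall>\<^sub>F t in at_top. ((\<lambda>t. z t * exp (- c * t)) has_real_derivative g t * exp (- c * t)) (at t)"
      unfolding eventually_at_top_linorder
      by (rule exI[of _ 1], intro allI impI) (rule derivative_eq_intros z refl | simp add: algebra_simps)+
    show "\<forall>\<^sub>F t in at_top. ((\<lambda>t. exp (- c * t)) has_real_derivative - c * exp (- c * t)) (at t)"
      by (intro always_eventually allI) (rule derivative_eq_intros refl | simp)+
    have "((\<lambda>t. g t / (- c)) \<longlongrightarrow> 0 / (- c)) at_top"
      using c by (intro tendsto_divide g tendsto_const) auto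
    then show "((\<lambda>t. g t * exp (- c * t) / (- c * exp (- c * t))) \<longlongrightarrow> 0) at_top"
      by simp
  qed (use c in auto)
  then show ?thesis by simp
qed

text \<open>The Maclaurin remainder of order \<open>n\<close> is at most
  \<open>K * (d * \<bar>t\<bar>) ^ n / fact n\<close>, which tends to 0 as \<open>n\<close>
  grows.\<close>

lemma flat_at_0_imp_zero:
  fixes D :: "nat \<Rightarrow> real \<Rightarrow> real"
  assumes D: "\<And>k t. (D k has_real_derivative D (Suc k) t) (at t)"
    and bound: "\<And>k t. \<bar>D k t\<bar> \<le> K * d ^ k"
    and flat: "\<And>k. D k 0 = 0"
  shows "D 0 t = 0"
proof -
  have bd: "norm (D 0 t) \<le> K * ((d * \<bar>t\<bar>) ^ n / fact n)" for n
  proof -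
    from Maclaurin_all_le[of D "D 0" t n] D flat
    obtain s where "D 0 t = D n s / fact n * t ^ n" by auto
    then have "\<bar>D 0 t\<bar> = \<bar>D n s\<bar> * (\<bar>t\<bar> ^ n / fact n)"
      by (simp add: abs_mult power_abs)
    also have "\<dots> \<le> (K * d ^ n) * (\<bar>t\<bar> ^ n / fact n)"
      using bound[of n s] by (intro mult_right_mono) auto
    finally show ?thesis by (simp add: power_mult_distrib)
  qed
  have "(\<lambda>n. (d * \<bar>t\<bar>) ^ n / fact n) \<longlonglongrightarrow> 0"
    using summable_LIMSEQ_zero[OF summable_exp[of "d * \<bar>t\<bar>"]] by (simp add: divide_inverse mult.commute)
  then have "(\<lambda>n. K * ((d * \<bar>t\<bar>) ^ n / fact n)) \<longlonglongrightarrow> K * 0" by (intro tendsto_mult tendsto_const)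
  then have "norm (D 0 t) \<le> K * 0"
    by (rule tendsto_lowerbound) (use bd in auto)
  then show ?thesis by simp
qed

text \<open>Bolzano-Weierstrass for finitely many bounded sequences: each index in turn is treated
  by passing to a monotone subsequence, which keeps the limits found before.\<close>

lemma finite_family_convergent_subseq:
  fixes f :: "'i \<Rightarrow> nat \<Rightarrow> real"
  assumes "finite I" and "\<And>i n. i \<in> I \<Longrightarrow> \<bar>f i n\<bar> \<le> K"
  shows "\<exists>r. strict_mono r \<and> (\<forall>i\<in>I. convergent (f i \<circ> r))"
  using assms
proof (induction I rule: finite_induct)
  case empty
  show ?case by (intro exI[of _ id]) (auto simp: strict_mono_def)
next
  case (insert i I)
  have "\<exists>r. strict_mono r \<and> (\<forall>i\<in>I. convergent (f i \<circ> r))"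
    by (rule insert.IH) (use insert.prems in auto)
  then obtain r where r: "strict_mono r" "\<And>j. j \<in> I \<Longrightarrow> convergent (f j \<circ> r)" by auto
  obtain s where s: "strict_mono s" "monoseq (\<lambda>n. (f i \<circ> r) (s n))"
    using seq_monosub[of "f i \<circ> r"] by auto
  have "Bseq (\<lambda>n. (f i \<circ> r) (s n))"
    by (rule BseqI'[of _ K]) (use insert.prems in auto)
  with s(2) have "convergent (\<lambda>n. (f i \<circ> r) (s n))" by (intro Bseq_monoseq_convergent)
  moreover have "convergent (f j \<circ> (r \<circ> s))" if "j \<in> I" for j
    using convergent_subseq_convergent[OF r(2)[OF that] s(1)] by (simp add: o_assoc)
  ultimately show ?case
    using strict_mono_o[OF r(1) s(1)] by (intro exI[of _ "r \<circ> s"]) (auto simp: o_def)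
qed

subsection \<open>Jordan matrices as bidiagonal matrices\<close>

text \<open>A Jordan matrix without explicit blocks: \<open>l\<close> lists the eigenvalues, and
  zeros of \<open>e\<close> mark the block boundaries. Eigenvalues can then be changed while
  \<open>e\<close> stays fixed.\<close>

definition bidiag_mat :: "nat \<Rightarrow> (nat \<Rightarrow> 'a) \<Rightarrow> (nat \<Rightarrow> 'a) \<Rightarrow> 'a :: semiring_1 mat" where
  "bidiag_mat n l e = mat n n (\<lambda>(i, j). if i = j then l i else if j = Suc i then e i else 0)"

lemma bidiag_mat_carrier [simp]: "bidiag_mat n l e \<in> carrier_mat n n"
  by (simp add: bidiag_mat_def)

lemma bidiag_mat_dim [simp]: "dim_row (bidiag_mat n l e) = n" "dim_col (bidiag_mat n l e) = n"
  by (simp_all add: bidiag_mat_def)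

lemma bidiag_mat_mult_index:
  assumes X: "X \<in> carrier_mat n k" and i: "i < n" and j: "j < k"
  shows "(bidiag_mat n l e * X) $$ (i, j) =
    l i * X $$ (i, j) + (if Suc i < n then e i * X $$ (Suc i, j) else 0)"
proof -
  have "(bidiag_mat n l e * X) $$ (i, j) = (\<Sum>r<n. bidiag_mat n l e $$ (i, r) * X $$ (r, j))"
    using assms by (auto simp: scalar_prod_def bidiag_mat_def lessThan_atLeast0 intro!: sum.cong)
  also have "\<dots> = (\<Sum>r<n. (if r = i then l i * X $$ (i, j) else 0) + (if r = Suc i then e i * X $$ (Suc i, j) else 0))"
    using i by (intro sum.cong) (auto simp: bidiag_mat_def)
  finally show ?thesis using i by (simp add: sum.distrib)
qed

lemma mult_bidiag_mat_index:
  assumes X: "X \<in> carrier_mat k n" and i: "i < k" and j: "j < n"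
  shows "(X * bidiag_mat n l e) $$ (i, j) =
    X $$ (i, j) * l j + (if j > 0 then X $$ (i, j - 1) * e (j - 1) else 0)"
proof -
  have "(X * bidiag_mat n l e) $$ (i, j) = (\<Sum>r<n. X $$ (i, r) * bidiag_mat n l e $$ (r, j))"
    using assms by (auto simp: scalar_prod_def bidiag_mat_def lessThan_atLeast0 intro!: sum.cong)
  also have "\<dots> = (\<Sum>r<n. (if r = j then X $$ (i, j) * l j else 0) +
      (if r = j - 1 then if j > 0 then X $$ (i, j - 1) * e (j - 1) else 0 else 0))"
    using j by (intro sum.cong) (auto simp: bidiag_mat_def)
  finally show ?thesis using j less_imp_diff_less[OF j, of 1] by (simp add: sum.distrib)
qed

text \<open>This is what is kept of the block structure: a nonzero superdiagonal entry only joins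
  indices that carry the same eigenvalue.\<close>

definition constant_on_couplings :: "nat \<Rightarrow> (nat \<Rightarrow> 'a) \<Rightarrow> (nat \<Rightarrow> 'b :: zero) \<Rightarrow> bool" where
  "constant_on_couplings n l e \<longleftrightarrow> (\<forall>i. Suc i < n \<and> e i \<noteq> 0 \<longrightarrow> l i = l (Suc i))"

lemma constant_on_couplingsD:
  "constant_on_couplings n l e \<Longrightarrow> Suc i < n \<Longrightarrow> e i \<noteq> 0 \<Longrightarrow> l i = l (Suc i)"
  by (simp add: constant_on_couplings_def)

text \<open>One pair \<open>l\<close>, \<open>e\<close> serves all maps \<open>f\<close> of the
  eigenvalues at once, so a Jordan matrix and its real part share the same couplings.\<close>

lemma jordan_matrix_bidiag:
  fixes bs :: "(nat \<times> 'a :: semiring_1) list"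
  shows "\<exists>l e. constant_on_couplings (sum_list (map fst bs)) l e \<and>
    (\<forall>f. jordan_matrix (map (\<lambda>(p, x). (p, f x)) bs) =
      (bidiag_mat (sum_list (map fst bs)) (\<lambda>i. f (l i)) e :: 'b :: semiring_1 mat))"
proof (induction bs)
  case Nil
  show ?case
    by (intro exI[of _ undefined] conjI allI eq_matI) (auto simp: jordan_matrix_def bidiag_mat_def constant_on_couplings_def)
next
  case (Cons b bs)
  obtain p x where b: "b = (p, x)" by (cases b)
  let ?n = "sum_list (map fst bs)"
  obtain l and e :: "nat \<Rightarrow> 'b" where l: "constant_on_couplings ?n l e"
    and J: "\<And>f. jordan_matrix (map (\<lambda>(p, x). (p, f x)) bs) = bidiag_mat ?n (\<lambda>i. f (l i)) e"
    using Cons.IH by metis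
  let ?l = "\<lambda>i. if i < p then x else l (i - p)"
  \<comment> \<open>The zero at \<open>Suc i = p\<close> separates the new block from the shifted
    rest.\<close>
  let ?e = "\<lambda>i. if Suc i < p then 1 else if Suc i = p then 0 else e (i - p)"
  have fst: "map fst (map (\<lambda>(p, x). (p, f x)) bs) = map fst bs" for f :: "'a \<Rightarrow> 'b"
    by auto
  have "jordan_matrix (map (\<lambda>(p, x). (p, f x)) (b # bs)) = bidiag_mat (p + ?n) (\<lambda>i. f (?l i)) ?e" for f
    unfolding list.map b prod.case jordan_matrix_Cons fst J
    by (rule eq_matI) (auto simp: bidiag_mat_def Suc_diff_le split: if_splits)
  moreover have "?l i = ?l (Suc i)" if "Suc i < p + ?n" "?e i \<noteq> 0" for i
    using that constant_on_couplingsD[OF l, of "i - p"] by (cases "Suc i < p") (auto simp: Suc_diff_le split: if_splits)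
  ultimately show ?case
    by (intro exI[of _ ?l] exI[of _ ?e]) (auto simp: b constant_on_couplings_def)
qed

subsection \<open>Bounded solutions in Jordan coordinates\<close>

text \<open>Since \<open>c\<close> is real, the real and imaginary parts of \<open>z\<close> solve
  the same real equation. For \<open>c = 0\<close> the decay comes from the bounded antiderivative
  \<open>y\<close>, otherwise from \<open>linear_ode_bounded_tendsto_0\<close>.\<close>

lemma complex_linear_ode_bounded_derivative_tendsto_0:
  fixes y z g :: "real \<Rightarrow> complex" and c :: real
  assumes y: "\<And>t. t > 0 \<Longrightarrow> (y has_vector_derivative z t) (at t)"
    and z: "\<And>t. t > 0 \<Longrightarrow> (z has_vector_derivative of_real c * z t + g t) (at t)"
    and K: "\<And>t. t > 0 \<Longrightarrow> norm (y t) \<le> K" and M: "\<And>t. t > 0 \<Longrightarrow> norm (z t) \<le> M"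
    and g: "(g \<longlongrightarrow> 0) at_top"
  shows "(z \<longlongrightarrow> 0) at_top"
proof -
  have real_case: "((\<lambda>t. p (z t)) \<longlongrightarrow> 0) at_top"
    if p: "bounded_linear p" "\<And>x. \<bar>p x\<bar> \<le> norm x" "\<And>x. p (of_real c * x) = c * p x" for p :: "complex \<Rightarrow> real"
  proof -
    have py: "((\<lambda>t. p (y t)) has_real_derivative p (z t)) (at t)" if "t > 0" for t
      using bounded_linear.has_vector_derivative[OF p(1) y[OF that]]
      by (simp add: has_real_derivative_iff_has_vector_derivative)
    have pz: "((\<lambda>t. p (z t)) has_real_derivative c * p (z t) + p (g t)) (at t)" if "t > 0" for t
      using bounded_linear.has_vector_derivative[OF p(1) z[OF that]]
      by (simp add: has_real_derivative_iff_has_vector_derivative linear_add[OF bounded_linear.linear[OF p(1)]] p(3))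
    have pg: "((\<lambda>t. p (g t)) \<longlongrightarrow> 0) at_top"
      by (rule tendsto_0_le[OF g, of _ 1]) (use p(2) in auto)
    have pK: "\<bar>p (y t)\<bar> \<le> K" "\<bar>p (z t)\<bar> \<le> M" if "t > 0" for t
      using p(2)[of "y t"] p(2)[of "z t"] K[OF that] M[OF that] by linarith+
    show ?thesis
    proof (cases "c = 0")
      case True
      show ?thesis
        by (rule derivative_tendsto_0_of_bounded[OF py _ pK(1) pg]) (use pz True in auto)
    qed (rule linear_ode_bounded_tendsto_0[OF pz pK(2) pg])
  qed
  have "((\<lambda>t. Complex (Re (z t)) (Im (z t))) \<longlongrightarrow> Complex 0 0) at_top"
    by (intro tendsto_Complex real_case bounded_linear_Re bounded_linear_Im abs_Re_le_cmod abs_Im_le_cmod) auto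
  then show ?thesis by (simp flip: zero_complex.code)
qed

lemma has_vector_derivative_cis:
  "((\<lambda>s. cis (w * s)) has_vector_derivative \<i> * of_real w * cis (w * t)) (at t)"
proof -
  have "((\<lambda>z. exp (\<i> * of_real w * z)) has_field_derivative \<i> * of_real w * exp (\<i> * of_real w * of_real t)) (at (of_real t))"
    by (rule derivative_eq_intros refl | simp)+
  from has_vector_derivative_real_field[OF this] show ?thesis
    by (simp add: cis_conv_exp mult.assoc)
qed

text \<open>Multiplying entry \<open>(i, j)\<close> by \<open>exp (\<i> t (Im l\<^sub>i - Im l'\<^sub>j) / 2)\<close> turns the equation
  \<open>2 X' = X J' - J X\<close> into the same equation for the real parts of \<open>J\<close> and \<open>J'\<close>, which is
  triangular with real coefficients.\<close>

lemma bounded_intertwiner_real_part_tendsto_0: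
  fixes X :: "real \<Rightarrow> complex mat" and l e l' e' :: "nat \<Rightarrow> complex"
  assumes l: "constant_on_couplings n l e"
    and l': "constant_on_couplings n l' e'"
    and X: "\<And>t. X t \<in> carrier_mat n n"
    and D: "\<And>t i j. t > 0 \<Longrightarrow> i < n \<Longrightarrow> j < n \<Longrightarrow> ((\<lambda>s. X s $$ (i, j)) has_vector_derivative
      (X t * bidiag_mat n l' e' - bidiag_mat n l e * X t) $$ (i, j) / 2) (at t)"
    and K: "\<And>t. t > 0 \<Longrightarrow> norm_bound (X t) K"
    and ij: "i < n" "j < n"
  shows "((\<lambda>t. (bidiag_mat n (\<lambda>i. of_real (Re (l i))) e * X t
    - X t * bidiag_mat n (\<lambda>i. of_real (Re (l' i))) e') $$ (i, j)) \<longlongrightarrow> 0) at_top"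
proof -
  define w where "w i j = (Im (l i) - Im (l' j)) / 2" for i j
  define y where "y i j t = cis (w i j * t) * X t $$ (i, j)" for i j t
  define c where "c i j = (Re (l' j) - Re (l i)) / 2" for i j
  \<comment> \<open>\<open>F\<close> collects the coupling terms. It is linear with constant
    coefficients, so \<open>z\<close>, the derivative of \<open>y\<close>, satisfies the same
    equation as \<open>y\<close>.\<close>
  define F where "F h i j t = ((if j > 0 then h i (j - 1) t * e' (j - 1) else 0)
    - (if Suc i < n then e i * h (Suc i) j t else 0)) / 2" for h :: "nat \<Rightarrow> nat \<Rightarrow> real \<Rightarrow> complex" and i j t
  define z where "z i j t = of_real (c i j) * y i j t + F y i j t" for i j t
  \<comment> \<open>A nonzero coupling joins equal eigenvalues, so the phase passes unchanged
    through the coupling terms.\<close>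
  have w_l: "e i * cis (w i j * t) = e i * cis (w (Suc i) j * t)" if "Suc i < n" for i j t
    using constant_on_couplingsD[OF l that] by (cases "e i = 0") (auto simp: w_def)
  have w_l': "cis (w i j * t) * e' (j - 1) = cis (w i (j - 1) * t) * e' (j - 1)" if "0 < j" "j < n" for i j t
    using constant_on_couplingsD[OF l', of "j - 1"] that by (cases "e' (j - 1) = 0") (auto simp: w_def)
  \<comment> \<open>The map \<open>p\<close> is left free: the identity gives the differential
    equation for \<open>y\<close>, the real part gives the matrix in the conclusion.\<close>
  have intertw: "cis (w i j * t) * (X t * bidiag_mat n (\<lambda>i. p (l' i)) e' - bidiag_mat n (\<lambda>i. p (l i)) e * X t) $$ (i, j) / 2
      = (p (l' j) - p (l i)) / 2 * y i j t + F y i j t" if i: "i < n" and j: "j < n" for i j t and p :: "complex \<Rightarrow> complex"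
  proof -
    have a: "X t $$ (i, j - 1) * (cis (w i j * t) * e' (j - 1)) = y i (j - 1) t * e' (j - 1)" if "j > 0"
      unfolding w_l'[OF that j] y_def by (simp add: mult_ac)
    have b: "(e i * cis (w i j * t)) * X t $$ (Suc i, j) = e i * y (Suc i) j t" if "Suc i < n"
      unfolding w_l[OF that] y_def by (simp add: mult_ac)
    have "cis (w i j * t) * (X t * bidiag_mat n (\<lambda>i. p (l' i)) e' - bidiag_mat n (\<lambda>i. p (l i)) e * X t) $$ (i, j) / 2 =
      ((p (l' j) - p (l i)) / 2) * y i j t +
       ((if j > 0 then X t $$ (i, j - 1) * (cis (w i j * t) * e' (j - 1)) else 0)
       - (if Suc i < n then (e i * cis (w i j * t)) * X t $$ (Suc i, j) else 0)) / 2"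
      using i j X[of t]
      by (simp add: mult_bidiag_mat_index[of _ n] bidiag_mat_mult_index[of _ _ n] y_def carrier_matD[OF X]
        del: index_mult_mat(1)) (simp add: field_simps)
    also have "\<dots> = ((p (l' j) - p (l i)) / 2) * y i j t + F y i j t"
      by (cases "j > 0"; cases "Suc i < n") (simp_all only: F_def a b if_True if_False)
    finally show ?thesis .
  qed
  have y: "(y i j has_vector_derivative z i j t) (at t)" if "t > 0" "i < n" "j < n" for i j t
  proof -
    let ?d = "(X t * bidiag_mat n l' e' - bidiag_mat n l e * X t) $$ (i, j) / 2"
    have "(y i j has_vector_derivative cis (w i j * t) * ?d + \<i> * of_real (w i j) * cis (w i j * t) * X t $$ (i, j)) (at t)"
      unfolding y_def using has_vector_derivative_mult[OF has_vector_derivative_cis D[OF that]] by simp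
    also have "cis (w i j * t) * ?d + \<i> * of_real (w i j) * cis (w i j * t) * X t $$ (i, j)
      = (l' j - l i) / 2 * y i j t + F y i j t + \<i> * of_real (w i j) * y i j t"
      using intertw[OF that(2,3), of t "\<lambda>x. x"] by (simp add: y_def)
    also have "\<dots> = ((l' j - l i) / 2 + \<i> * of_real (w i j)) * y i j t + F y i j t"
      by (simp add: algebra_simps)
    \<comment> \<open>The phase is chosen to cancel exactly the imaginary part of the diagonal
      coefficient.\<close>
    also have "(l' j - l i) / 2 + \<i> * of_real (w i j) = of_real (c i j)"
      by (simp add: complex_eq_iff w_def c_def field_simps)
    finally show ?thesis by (simp add: z_def)
  qed
  have z: "(z i j has_vector_derivative of_real (c i j) * z i j t + F z i j t) (at t)"
    if t: "t > 0" and i: "i < n" and j: "j < n" for i j t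
  proof -
    have 1: "((\<lambda>s. if j > 0 then y i (j - 1) s * e' (j - 1) else 0) has_vector_derivative
        (if j > 0 then z i (j - 1) t * e' (j - 1) else 0)) (at t)"
      using y[OF t i, of "j - 1"] j by (auto intro!: derivative_intros)
    have 2: "((\<lambda>s. if Suc i < n then e i * y (Suc i) j s else 0) has_vector_derivative
        (if Suc i < n then e i * z (Suc i) j t else 0)) (at t)"
      using y[OF t _ j, of "Suc i"] by (auto intro!: derivative_intros)
    have zf: "z i j = (\<lambda>t. of_real (c i j) * y i j t + F y i j t)" by (simp add: z_def fun_eq_iff)
    have "((\<lambda>t. of_real (c i j) * y i j t + F y i j t) has_vector_derivative
        of_real (c i j) * z i j t + F z i j t) (at t)"
      unfolding F_def
      by (intro has_vector_derivative_add has_vector_derivative_mult_right y t i j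
          has_vector_derivative_divide has_vector_derivative_diff 1 2)
    then show ?thesis unfolding zf[symmetric] .
  qed
  have yK: "norm (y i j t) \<le> K" if "t > 0" "i < n" "j < n" for i j t
    using K[OF that(1)] that(2,3) X[of t] by (auto simp: y_def norm_mult norm_bound_def)
  have zM: "norm (z i j t) \<le> \<bar>c i j\<bar> * K + (K * norm (e' (j - 1)) + norm (e i) * K) / 2"
    if t: "t > 0" and i: "i < n" and j: "j < n" for i j t
  proof -
    have K0: "K \<ge> 0" using yK[OF that] norm_ge_zero order_trans by blast
    let ?a = "if j > 0 then y i (j - 1) t * e' (j - 1) else 0"
    let ?b = "if Suc i < n then e i * y (Suc i) j t else 0"
    have "norm ?a \<le> K * norm (e' (j - 1))" "norm ?b \<le> norm (e i) * K"
      using yK[OF t i, of "j - 1"] yK[OF t _ j, of "Suc i"] K0 j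
      by (auto simp: norm_mult intro: mult_mono)
    moreover have "norm (?a - ?b) \<le> norm ?a + norm ?b" by (rule norm_triangle_ineq4)
    ultimately have "norm (F y i j t) \<le> (K * norm (e' (j - 1)) + norm (e i) * K) / 2"
      unfolding F_def norm_divide by simp
    moreover have "norm (of_real (c i j) * y i j t) \<le> \<bar>c i j\<bar> * K"
      using yK[OF that] by (simp add: norm_mult mult_left_mono)
    ultimately show ?thesis unfolding z_def by (intro norm_triangle_le add_mono)
  qed
  have z0: "(z i j \<longlongrightarrow> 0) at_top" if "i < n" "j < n" for i j
    using that
  \<comment> \<open>The equation for entry \<open>(i, j)\<close> is forced only by the entries
    \<open>(i, j - 1)\<close> and \<open>(Suc i, j)\<close>, both of smaller weight
    \<open>j + (n - i)\<close>.\<close>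
  proof (induction "j + (n - i)" arbitrary: i j rule: less_induct)
    case less
    have "(F z i j \<longlongrightarrow> (0 - 0) / 2) at_top" unfolding F_def
    proof (intro tendsto_divide tendsto_diff tendsto_const)
      show "((\<lambda>t. if 0 < j then z i (j - 1) t * e' (j - 1) else 0) \<longlongrightarrow> 0) at_top"
        using less.hyps[of "j - 1" i] less.prems by (cases "j > 0") (auto intro!: tendsto_mult_left_zero)
      show "((\<lambda>t. if Suc i < n then e i * z (Suc i) j t else 0) \<longlongrightarrow> 0) at_top"
      proof (cases "Suc i < n")
        case True
        then have "j + (n - Suc i) < j + (n - i)" by simp
        from less.hyps[OF this True] less.prems True show ?thesis
          by (auto intro!: tendsto_mult_right_zero)
      qed simp
    qed simp
    then have "(F z i j \<longlongrightarrow> 0) at_top" by simp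
    from complex_linear_ode_bounded_derivative_tendsto_0[OF y z yK zM this] less.prems
    show ?case by blast
  qed
  have "((\<lambda>t. - 2 * z i j t) \<longlongrightarrow> - 2 * 0) at_top"
    by (intro tendsto_mult tendsto_const z0 ij)
  then have lim: "((\<lambda>t. - 2 * z i j t) \<longlongrightarrow> 0) at_top" by simp
  let ?R = "\<lambda>t. bidiag_mat n (\<lambda>i. of_real (Re (l i))) e * X t - X t * bidiag_mat n (\<lambda>i. of_real (Re (l' i))) e'"
  \<comment> \<open>The entry differs from \<open>- 2 * z i j t\<close> only by a unimodular
    factor.\<close>
  have "norm (?R t $$ (i, j)) = norm (- 2 * z i j t)" for t
  proof -
    let ?P = "X t * bidiag_mat n (\<lambda>i. of_real (Re (l' i))) e' - bidiag_mat n (\<lambda>i. of_real (Re (l i))) e * X t"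
    have "?R t $$ (i, j) = - ?P $$ (i, j)"
      using ij X[of t] by (simp del: index_mult_mat(1))
    then have "cis (w i j * t) * ?R t $$ (i, j) = - 2 * (cis (w i j * t) * ?P $$ (i, j) / 2)"
      by simp
    also have "\<dots> = - 2 * z i j t"
      unfolding intertw[OF ij, of t "\<lambda>x. of_real (Re x)"] z_def c_def by simp
    finally have "cis (w i j * t) * ?R t $$ (i, j) = - 2 * z i j t" .
    then show ?thesis by (metis mult_1 norm_cis norm_mult)
  qed
  then show ?thesis by (intro tendsto_0_le[OF lim, of _ 1]) auto
qed

text \<open>A constant \<open>X\<close> intertwining the Jordan matrices is a bounded stationary
  solution of the flow, so the decay result says that a constant tends to 0, hence is 0.\<close>

lemma intertwiner_real_part:
  fixes X :: "complex mat" and l e l' e' :: "nat \<Rightarrow> complex"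
  assumes l: "constant_on_couplings n l e"
    and l': "constant_on_couplings n l' e'"
    and X: "X \<in> carrier_mat n n"
    and eq: "bidiag_mat n l e * X = X * bidiag_mat n l' e'"
  shows "bidiag_mat n (\<lambda>i. of_real (Re (l i))) e * X = X * bidiag_mat n (\<lambda>i. of_real (Re (l' i))) e'"
    (is "?L = ?R")
proof (rule eq_matI)
  fix i j assume "i < dim_row ?R" "j < dim_col ?R"
  then have ij: "i < n" "j < n" using X by (auto simp: bidiag_mat_def)
  obtain K where K: "norm_bound X K" using norm_bound_max by blast
  have "((\<lambda>t::real. (?L - ?R) $$ (i, j)) \<longlongrightarrow> 0) at_top"
  proof (rule bounded_intertwiner_real_part_tendsto_0[where X = "\<lambda>_. X", OF l l' X _ K ij])
    fix t :: real and i j assume "t > 0" and ij: "i < n" "j < n"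
    have "(X * bidiag_mat n l' e' - bidiag_mat n l e * X) $$ (i, j) = 0"
      unfolding eq using ij X by (simp del: index_mult_mat(1))
    then show "((\<lambda>s. X $$ (i, j)) has_vector_derivative (X * bidiag_mat n l' e' - bidiag_mat n l e * X) $$ (i, j) / 2) (at t)"
      by simp
  qed
  then have "(?L - ?R) $$ (i, j) = 0" by (simp add: tendsto_const_iff)
  then show "?L $$ (i, j) = ?R $$ (i, j)"
    using ij X by (simp del: index_mult_mat(1))
qed (use X in \<open>auto simp: bidiag_mat_def\<close>)

subsection \<open>The real part of a matrix\<close>

text \<open>The change of basis \<open>S * T'\<close> intertwines the two Jordan forms, hence also
  their real parts. This makes the real part independent of the chosen Jordan form.\<close>

lemma conjugated_real_part_unique:
  fixes T S T' S' :: "complex mat" and l e l' e' :: "nat \<Rightarrow> complex"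
  assumes l: "constant_on_couplings n l e"
    and l': "constant_on_couplings n l' e'"
    and T: "T \<in> carrier_mat n n" "S \<in> carrier_mat n n" "T * S = 1\<^sub>m n" "S * T = 1\<^sub>m n"
    and T': "T' \<in> carrier_mat n n" "S' \<in> carrier_mat n n" "T' * S' = 1\<^sub>m n" "S' * T' = 1\<^sub>m n"
    and eq: "T * bidiag_mat n l e * S = T' * bidiag_mat n l' e' * S'"
  shows "T * bidiag_mat n (\<lambda>i. of_real (Re (l i))) e * S = T' * bidiag_mat n (\<lambda>i. of_real (Re (l' i))) e' * S'"
proof -
  note [simp] = T(1,2) T'(1,2)
  note assoc = assoc_mult_mat[of _ n n _ n _ n] mult_carrier_mat[of _ n n _ n] right_mult_one_mat[of _ n n] left_mult_one_mat[of _ n n]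
  let ?J = "bidiag_mat n l e" and ?J' = "bidiag_mat n l' e'"
  let ?R = "bidiag_mat n (\<lambda>i. of_real (Re (l i))) e" and ?R' = "bidiag_mat n (\<lambda>i. of_real (Re (l' i))) e'"
  have "?J * (S * T') = (S * T) * ?J * (S * T')"
    by (simp add: T)
  also have "\<dots> = S * (T * ?J * S) * T'" by (simp add: assoc)
  also have "\<dots> = (S * T') * ?J' * (S' * T')" unfolding eq by (simp add: assoc)
  also have "\<dots> = (S * T') * ?J'" by (simp add: T' assoc)
  finally have "?R * (S * T') = (S * T') * ?R'"
    by (intro intertwiner_real_part[OF l l']) (simp add: assoc)
  then have R: "?R * S * T' = S * T' * ?R'" by (simp add: assoc)
  have "T * ?R * S = T * ?R * S * (T' * S')" by (simp add: T' assoc)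
  also have "\<dots> = T * (?R * S * T') * S'" by (simp add: assoc)
  also have "\<dots> = (T * S) * T' * ?R' * S'" unfolding R by (simp add: assoc)
  also have "\<dots> = T' * ?R' * S'" by (simp add: T assoc)
  finally show ?thesis .
qed

lemma is_real_part_mat_bidiagE:
  assumes A: "A \<in> carrier_mat n n" and R: "is_real_part_mat A R"
  obtains T S l e where "T \<in> carrier_mat n n" "S \<in> carrier_mat n n" "T * S = 1\<^sub>m n" "S * T = 1\<^sub>m n"
    "constant_on_couplings n l e"
    "map_mat of_real A = T * bidiag_mat n l e * S"
    "map_mat of_real R = T * bidiag_mat n (\<lambda>i. complex_of_real (Re (l i))) e * S"
    "R \<in> carrier_mat n n"
proof -
  from R obtain T S bs where A': "similar_mat_wit (map_mat complex_of_real A) (jordan_matrix bs) T S"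
    and R': "similar_mat_wit (map_mat complex_of_real R)
       (jordan_matrix (map (\<lambda>(p, l). (p, complex_of_real (Re l))) bs)) T S"
    unfolding is_real_part_mat_def by auto
  have A'': "jordan_matrix bs \<in> carrier_mat n n" "T \<in> carrier_mat n n" "S \<in> carrier_mat n n" "T * S = 1\<^sub>m n" "S * T = 1\<^sub>m n"
    "map_mat of_real A = T * jordan_matrix bs * S"
    using A A' by (auto simp: similar_mat_wit_def Let_def)
  have n: "sum_list (map fst bs) = n" using A''(1) by auto
  obtain l and e :: "nat \<Rightarrow> complex" where l: "constant_on_couplings n l e"
    and J: "\<And>f. jordan_matrix (map (\<lambda>(p, x). (p, f x)) bs) = bidiag_mat n (\<lambda>i. f (l i)) e"
    using jordan_matrix_bidiag[of bs] unfolding n by blast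
  have R'': "map_mat of_real R = T * bidiag_mat n (\<lambda>i. complex_of_real (Re (l i))) e * S"
    using R' unfolding J[of "\<lambda>l. of_real (Re l)"] by (auto simp: similar_mat_wit_def Let_def)
  have "map_mat complex_of_real R \<in> carrier_mat n n" unfolding R'' using A'' by auto
  then have "R \<in> carrier_mat n n" by simp
  with that[OF A''(2-5) l _ R''] J[of "\<lambda>x. x"] A''(6) show ?thesis by (simp add: case_prod_beta')
qed

lemma is_real_part_mat_unique:
  assumes A: "A \<in> carrier_mat n n" and R: "is_real_part_mat A R" "is_real_part_mat A R'"
  shows "R = R'"
proof -
  from is_real_part_mat_bidiagE[OF A R(1)] obtain T S l e where
    1: "T \<in> carrier_mat n n" "S \<in> carrier_mat n n" "T * S = 1\<^sub>m n" "S * T = 1\<^sub>m n"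
    and l: "constant_on_couplings n l e"
    and A1: "map_mat of_real A = T * bidiag_mat n l e * S"
    and R1: "map_mat of_real R = T * bidiag_mat n (\<lambda>i. complex_of_real (Re (l i))) e * S"
    by metis
  from is_real_part_mat_bidiagE[OF A R(2)] obtain T' S' l' e' where
    2: "T' \<in> carrier_mat n n" "S' \<in> carrier_mat n n" "T' * S' = 1\<^sub>m n" "S' * T' = 1\<^sub>m n"
    and l': "constant_on_couplings n l' e'"
    and A2: "map_mat of_real A = T' * bidiag_mat n l' e' * S'"
    and R2: "map_mat of_real R' = T' * bidiag_mat n (\<lambda>i. complex_of_real (Re (l' i))) e' * S'"
    by metis
  have "map_mat complex_of_real R = map_mat of_real R'"
    unfolding R1 R2 by (rule conjugated_real_part_unique[OF l l' 1 2]) (simp_all add: A1[symmetric] A2[symmetric])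
  then show ?thesis by (rule of_real_hom.mat_hom_inj)
qed

text \<open>Entrywise conjugation turns a Jordan decomposition of a real matrix into another one with
  the same real parts, so by uniqueness the real part is invariant under conjugation.\<close>

lemma is_real_part_mat_exists:
  assumes A: "A \<in> carrier_mat n n"
  shows "\<exists>R. is_real_part_mat A R"
proof -
  let ?A = "map_mat complex_of_real A"
  have A': "?A \<in> carrier_mat n n" using A by simp
  from char_poly_factorized[OF A'] jordan_nf_exists[OF A'] obtain bs where "jordan_nf ?A bs" by blast
  then obtain T S where bs: "0 \<notin> fst ` set bs" and wit: "similar_mat_wit ?A (jordan_matrix bs) T S"
    unfolding jordan_nf_def similar_mat_def by auto
  have *: "jordan_matrix bs \<in> carrier_mat n n" and T: "T \<in> carrier_mat n n" "S \<in> carrier_mat n n" "T * S = 1\<^sub>m n" "S * T = 1\<^sub>m n"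
    and AJ: "?A = T * jordan_matrix bs * S"
    using A wit by (auto simp: similar_mat_wit_def Let_def)
  have n: "sum_list (map fst bs) = n" using * by auto
  obtain l and e :: "nat \<Rightarrow> complex" where l: "constant_on_couplings n l e"
    and J: "\<And>f. jordan_matrix (map (\<lambda>(p, x). (p, f x)) bs) = bidiag_mat n (\<lambda>i. f (l i)) e"
    using jordan_matrix_bidiag[of bs] unfolding n by blast
  have J1: "jordan_matrix bs = bidiag_mat n l e" using J[of "\<lambda>x. x"] by (simp add: case_prod_beta')
  let ?JR = "bidiag_mat n (\<lambda>i. complex_of_real (Re (l i))) e"
  interpret cnj: semiring_hom cnj by unfold_locales auto
  let ?c = "map_mat cnj"
  have cJ: "?c (bidiag_mat n f e) = bidiag_mat n (\<lambda>i. cnj (f i)) (\<lambda>i. cnj (e i))" for f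
    by (rule eq_matI) (auto simp: bidiag_mat_def)
  have cm: "?c (X * Y) = ?c X * ?c Y" if "X \<in> carrier_mat n n" "Y \<in> carrier_mat n n" for X Y
    by (rule cnj.mat_hom_mult[OF that])
  have "?c ?A = ?A" by (rule eq_matI) auto
  then have conjA: "T * bidiag_mat n l e * S = ?c T * bidiag_mat n (\<lambda>i. cnj (l i)) (\<lambda>i. cnj (e i)) * ?c S"
    unfolding AJ J1 using T by (simp add: cm cJ)
  have "T * ?JR * S = ?c T * bidiag_mat n (\<lambda>i. complex_of_real (Re (cnj (l i)))) (\<lambda>i. cnj (e i)) * ?c S"
  proof (rule conjugated_real_part_unique[OF l _ T _ _ _ _ conjA])
    show "constant_on_couplings n (\<lambda>i. cnj (l i)) (\<lambda>i. cnj (e i))"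
      using l by (simp add: constant_on_couplings_def)
    show "?c T * ?c S = 1\<^sub>m n" "?c S * ?c T = 1\<^sub>m n"
      using T by (simp_all add: cm[symmetric] cnj.mat_hom_one)
  qed (use T in auto)
  also have "\<dots> = ?c (T * ?JR * S)" using T by (simp add: cm cJ)
  finally have real: "?c (T * ?JR * S) = T * ?JR * S" ..
  \<comment> \<open>Entries fixed by conjugation are real, so passing to \<open>Re\<close> and back
    loses nothing.\<close>
  have RR: "map_mat of_real (map_mat Re (T * ?JR * S)) = T * ?JR * S" (is "?M = ?N")
  proof (rule eq_matI)
    fix i j assume ij: "i < dim_row ?N" "j < dim_col ?N"
    then have "cnj (?N $$ (i, j)) = ?N $$ (i, j)" by (subst (2) real[symmetric]) simp
    then show "?M $$ (i, j) = ?N $$ (i, j)" using ij by (simp add: Reals_cnj_iff del: index_mult_mat(1))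
  qed auto
  have "is_real_part_mat A (map_mat Re (T * ?JR * S))"
    unfolding is_real_part_mat_def
  proof (intro exI conjI)
    show "similar_mat_wit (map_mat complex_of_real (map_mat Re (T * ?JR * S)))
      (jordan_matrix (map (\<lambda>(p, l). (p, complex_of_real (Re l))) bs)) T S"
      unfolding RR J using T by (auto simp: similar_mat_wit_def Let_def)
  qed (use bs wit in auto)
  then show ?thesis by blast
qed

lemma real_part_mat_bidiagE:
  assumes A: "A \<in> carrier_mat n n"
  obtains T S l e where "T \<in> carrier_mat n n" "S \<in> carrier_mat n n" "T * S = 1\<^sub>m n" "S * T = 1\<^sub>m n"
    "constant_on_couplings n l e"
    "map_mat of_real A = T * bidiag_mat n l e * S"
    "map_mat of_real (real_part_mat A) = T * bidiag_mat n (\<lambda>i. complex_of_real (Re (l i))) e * S"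
    "real_part_mat A \<in> carrier_mat n n"
proof -
  have "is_real_part_mat A (real_part_mat A)"
    unfolding real_part_mat_def
    using is_real_part_mat_exists[OF A] is_real_part_mat_unique[OF A] by (blast intro: theI')
  from is_real_part_mat_bidiagE[OF A this] that show ?thesis by metis
qed

subsection \<open>The Sylvester operator and iterated commutators\<close>

lemmas square_mat_simps =
  assoc_mult_mat[of _ n n _ n _ n] mult_carrier_mat[of _ n n _ n] minus_carrier_mat[of _ n n]
  mult_minus_distrib_mat[of _ n n _ n] minus_mult_distrib_mat[of _ n n _ _ n]
  mult_smult_distrib[of _ n n _ n] mult_smult_assoc_mat[of _ n n _ n]
  right_mult_one_mat[of _ n n] left_mult_one_mat[of _ n n] for n

text \<open>This is the map \<Phi> of the overview: \<open>L' = sylvester A V L\<close> is the first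
  equation of \<open>L_equivalent\<close> solved for \<open>L'\<close>. With \<open>Q\<close> and
  \<open>G\<close> in place of \<open>A\<close> and \<open>V\<close>, its zeros are the matrices
  \<open>X\<close> with \<open>X * G = Q * X\<close>.\<close>

definition sylvester :: "'a :: field mat \<Rightarrow> 'a mat \<Rightarrow> 'a mat \<Rightarrow> 'a mat" where
  "sylvester A V X = (1 / 2) \<cdot>\<^sub>m (X * V - A * X)"

lemma sylvester_carrier [simp]:
  "A \<in> carrier_mat n n \<Longrightarrow> V \<in> carrier_mat n n \<Longrightarrow> X \<in> carrier_mat n n \<Longrightarrow> sylvester A V X \<in> carrier_mat n n"
  by (auto simp: sylvester_def)

lemma funpow_sylvester_carrier [simp]:
  "A \<in> carrier_mat n n \<Longrightarrow> V \<in> carrier_mat n n \<Longrightarrow> X \<in> carrier_mat n n \<Longrightarrow> (sylvester A V ^^ k) X \<in> carrier_mat n n"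
  by (induction k) auto

lemma commutator_carrier [simp]:
  "X \<in> carrier_mat n n \<Longrightarrow> Y \<in> carrier_mat n n \<Longrightarrow> commutator X Y \<in> carrier_mat n n"
  by (auto simp: commutator_def)

text \<open>Completing the square: the mixed terms \<open>A * X * V\<close> cancel. Along a solution
  of \<open>L' = \<Phi> L\<close> this turns the second equation of \<open>L_equivalent\<close> into
  \<open>L G = Q L\<close>.\<close>

lemma sylvester_twice:
  fixes A B V X :: "real mat"
  assumes [simp]: "A \<in> carrier_mat n n" "B \<in> carrier_mat n n" "V \<in> carrier_mat n n" "X \<in> carrier_mat n n"
  shows "4 \<cdot>\<^sub>m (sylvester A V (sylvester A V X) + A * sylvester A V X + B * X) =
    X * V ^\<^sub>m 2 + (4 \<cdot>\<^sub>m B - A ^\<^sub>m 2) * X"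
proof -
  note [simp] = carrier_matD[OF assms(1)] carrier_matD[OF assms(2)] carrier_matD[OF assms(3)] carrier_matD[OF assms(4)]
  note ac = square_mat_simps[where n = n]
  have pow: "M ^\<^sub>m 2 = M * M" if "M \<in> carrier_mat n n" for M :: "real mat"
    using that by (simp add: numeral_2_eq_2)
  have 1: "sylvester A V X = (1/2) \<cdot>\<^sub>m (X * V - A * X)" by (simp add: sylvester_def)
  have *: "(x * 4 - y * 4) / 2 - (y * 4 - z * 4) / 2 = x * 2 + z * 2 - 4 * y" for x y z :: real
    by (simp add: field_simps)
  have 2: "sylvester A V (sylvester A V X) = (1/4) \<cdot>\<^sub>m ((X * (V * V) - A * (X * V)) - (A * (X * V) - A * (A * X)))"
    unfolding sylvester_def by (rule eq_matI) (simp_all add: ac * del: index_mult_mat(1))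
  show ?thesis unfolding 2 unfolding 1
    by (rule eq_matI) (simp_all add: ac pow add_mult_distrib_mat[of _ n n _ _ n] del: index_mult_mat(1), simp add: field_simps)
qed

lemma smult_mat_cancel:
  "(c :: 'a :: field) \<noteq> 0 \<Longrightarrow> c \<cdot>\<^sub>m M = c \<cdot>\<^sub>m N \<longleftrightarrow> M = N"
  by (auto simp: mat_eq_iff)

lemma mat_diff_eq_swap:
  fixes a b c d :: "'a :: ab_group_add mat"
  assumes "a \<in> carrier_mat n n" "b \<in> carrier_mat n n" "c \<in> carrier_mat n n" "d \<in> carrier_mat n n"
  shows "a - b = c - d \<longleftrightarrow> c - a = d - b"
proof -
  have key: "x - y = u - v \<longleftrightarrow> u - x = v - y" for x y u v :: 'a
  proof -
    have "u - x - (v - y) = - (x - y - (u - v))" by (simp add: algebra_simps)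
    then show ?thesis by (metis eq_iff_diff_eq_0 neg_equal_0_iff_equal)
  qed
  have "a $$ (i, j) - b $$ (i, j) = c $$ (i, j) - d $$ (i, j) \<longleftrightarrow>
      c $$ (i, j) - a $$ (i, j) = d $$ (i, j) - b $$ (i, j)" for i j by (rule key)
  with assms show ?thesis by (simp add: mat_eq_iff)
qed

text \<open>Expanding with \<open>X * G = Q * X\<close> shows that twice the difference of the sides
  of the first equation is \<open>commutator Q A * X - X * commutator G V\<close>. One application
  of \<Phi> is thereby traded for one further commutator.\<close>

lemma sylvester_intertwines_iff:
  fixes A V G Q X :: "'a :: field_char_0 mat"
  assumes [simp]: "A \<in> carrier_mat n n" "V \<in> carrier_mat n n" "G \<in> carrier_mat n n" "Q \<in> carrier_mat n n" "X \<in> carrier_mat n n"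
    and eq: "X * G = Q * X"
  shows "sylvester A V X * G = Q * sylvester A V X \<longleftrightarrow> X * commutator G V = commutator Q A * X"
proof -
  note [simp] = carrier_matD[OF assms(1)] carrier_matD[OF assms(2)] carrier_matD[OF assms(3)] carrier_matD[OF assms(4)]
  note ac = square_mat_simps[where n = n]
  have eq': "X * (G * Z) = Q * (X * Z)" if "Z \<in> carrier_mat n n" for Z
  proof -
    have "X * (G * Z) = X * G * Z" using that by (simp add: ac)
    also have "\<dots> = Q * (X * Z)" unfolding eq using that by (simp add: ac)
    finally show ?thesis .
  qed
  let ?a = "X * (V * G)" and ?b = "A * (Q * X)" and ?c = "Q * (X * V)" and ?d = "Q * (A * X)"
  have 1: "sylvester A V X * G = (1/2) \<cdot>\<^sub>m (?a - ?b)" "Q * sylvester A V X = (1/2) \<cdot>\<^sub>m (?c - ?d)"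
    unfolding sylvester_def by (simp_all add: ac eq)
  have 2: "X * commutator G V = ?c - ?a" "commutator Q A * X = ?d - ?b"
    unfolding commutator_def by (simp_all add: ac eq')
  have 3 [simp]: "?a \<in> carrier_mat n n" "?b \<in> carrier_mat n n" "?c \<in> carrier_mat n n" "?d \<in> carrier_mat n n"
    by (simp_all add: ac)
  have "(1/2) \<cdot>\<^sub>m (?a - ?b) = (1/2) \<cdot>\<^sub>m (?c - ?d) \<longleftrightarrow> ?a - ?b = ?c - ?d"
    by (rule smult_mat_cancel) simp
  also have "\<dots> \<longleftrightarrow> ?c - ?a = ?d - ?b"
    by (rule mat_diff_eq_swap[OF 3])
  finally show ?thesis unfolding 1 2 .
qed

section \<open>Linear recurrences for iterated commutators\<close>

lemma iterated_commutator_replicate_0 [simp]: "iterated_commutator Q (replicate 0 A) = Q"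
  by (simp add: iterated_commutator_def)

lemma iterated_commutator_snoc:
  "iterated_commutator Q (As @ [X]) = commutator (iterated_commutator Q As) X"
  by (simp add: iterated_commutator_def)

lemma iterated_commutator_replicate_Suc:
  "iterated_commutator Q (replicate (Suc k) A) = commutator (iterated_commutator Q (replicate k A)) A"
  by (simp add: iterated_commutator_snoc flip: replicate_append_same)

lemma iterated_commutator_replicate_carrier [simp]:
  "Q \<in> carrier_mat n n \<Longrightarrow> A \<in> carrier_mat n n \<Longrightarrow> iterated_commutator Q (replicate k A) \<in> carrier_mat n n"
  by (induction k) (auto simp: iterated_commutator_replicate_Suc simp del: replicate.simps)

text \<open>Any \<open>N + 1\<close> vectors of length \<open>N\<close> are dependent, and the last
  vector with a nonzero coefficient is a combination of its predecessors.\<close>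

lemma nontrivial_linear_relation:
  fixes f :: "nat \<Rightarrow> nat \<Rightarrow> 'a :: field"
  shows "\<exists>r\<le>N. \<exists>w. \<forall>i<N. f r i = (\<Sum>k<r. w k * f k i)"
proof -
  \<comment> \<open>The vectors are the columns, padded by a zero row to a singular square
    matrix.\<close>
  define M where "M = mat (Suc N) (Suc N) (\<lambda>(i, k). if i < N then f k i else 0)"
  have M: "M \<in> carrier_mat (Suc N) (Suc N)" by (simp add: M_def)
  have "det M = 0"
  proof -
    have "M = mat\<^sub>r (Suc N) (Suc N) (\<lambda>i. if i = N then 0\<^sub>v (Suc N) else row M i)"
      by (rule eq_matI) (auto simp: M_def less_Suc_eq)
    then show ?thesis using det_row_0[of N "Suc N" "row M"] M by fastforce
  qed
  then obtain v where v: "v \<in> carrier_vec (Suc N)" "v \<noteq> 0\<^sub>v (Suc N)" "M *\<^sub>v v = 0\<^sub>v (Suc N)"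
    using det_0_iff_vec_prod_zero_field[OF M] by auto
  have rel: "(\<Sum>k<Suc N. v $ k * f k i) = 0" if "i < N" for i
  proof -
    have "(M *\<^sub>v v) $ i = (\<Sum>k<Suc N. v $ k * f k i)"
      using v(1) that by (auto simp: M_def scalar_prod_def lessThan_atLeast0 mult.commute intro!: sum.cong)
    then show ?thesis using v(3) that by simp
  qed
  define r where "r = Max {k. k \<le> N \<and> v $ k \<noteq> 0}"
  have "\<exists>k. k \<le> N \<and> v $ k \<noteq> 0"
  proof (rule ccontr)
    assume "\<not> ?thesis"
    then have "v = 0\<^sub>v (Suc N)" using v(1) by (intro eq_vecI) auto
    with v(2) show False by simp
  qed
  then have "r \<in> {k. k \<le> N \<and> v $ k \<noteq> 0}"
    unfolding r_def by (intro Max_in) auto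
  then have r: "r \<le> N" "v $ r \<noteq> 0" by auto
  have above: "v $ k = 0" if "k \<le> N" "r < k" for k
  proof (rule ccontr)
    assume "v $ k \<noteq> 0"
    then have "k \<le> r" using that unfolding r_def by (intro Max_ge) auto
    with that show False by simp
  qed
  have "f r i = (\<Sum>k<r. - (v $ k) / v $ r * f k i)" if i: "i < N" for i
  proof -
    have "0 = (\<Sum>k<Suc r. v $ k * f k i)"
      unfolding rel[OF i, symmetric] using r above by (intro sum.mono_neutral_right) auto
    then have "v $ r * f r i = - (\<Sum>k<r. v $ k * f k i)" by (simp add: eq_neg_iff_add_eq_0 add.commute)
    then have "f r i = - (\<Sum>k<r. v $ k * f k i) / v $ r" using r(2) by (simp add: field_simps)
    then show ?thesis by (simp add: sum_divide_distrib sum_negf)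
  qed
  with r(1) show ?thesis
    by (intro exI[of _ r] exI[of _ "\<lambda>k. - (v $ k) / v $ r"] conjI allI impI)
qed

text \<open>The first \<open>m\<^sup>2 + 1\<close> iterated commutators are linearly dependent, so they satisfy a linear
  recurrence of order at most \<open>m\<^sup>2\<close>.\<close>

lemma iterated_commutators_vanish:
  fixes Q A X :: "'a :: field mat"
  assumes [simp]: "Q \<in> carrier_mat m m" "A \<in> carrier_mat m m" "X \<in> carrier_mat m m"
    and vanish: "\<And>k. k < m\<^sup>2 \<Longrightarrow> iterated_commutator Q (replicate k A @ [X]) = 0\<^sub>m m m"
  shows "iterated_commutator Q (replicate k A @ [X]) = 0\<^sub>m m m"
proof -
  define K where "K k = iterated_commutator Q (replicate k A)" for k
  have K [simp]: "K k \<in> carrier_mat m m" for k by (simp add: K_def)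
  have K_Suc: "K (Suc k) = commutator (K k) A" for k by (simp add: K_def iterated_commutator_replicate_Suc del: replicate.simps)
  \<comment> \<open>Matrices are flattened to vectors of length \<open>m\<^sup>2\<close>, with entry
    \<open>(i, j)\<close> at position \<open>i * m + j\<close>.\<close>
  obtain r w where r: "r \<le> m\<^sup>2" and w: "\<And>i. i < m\<^sup>2 \<Longrightarrow> K r $$ (i div m, i mod m) = (\<Sum>k<r. w k * K k $$ (i div m, i mod m))"
    using nontrivial_linear_relation[of "m\<^sup>2" "\<lambda>k i. K k $$ (i div m, i mod m)"] by auto
  have com: "commutator Y Z $$ (i, j) = (\<Sum>k<r. w k * commutator (M k) Z $$ (i, j))"
    if "i < m" "j < m" and [simp]: "Y \<in> carrier_mat m m" "Z \<in> carrier_mat m m" "\<And>k. M k \<in> carrier_mat m m"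
      and Y: "\<And>i j. i < m \<Longrightarrow> j < m \<Longrightarrow> Y $$ (i, j) = (\<Sum>k<r. w k * M k $$ (i, j))" for Y Z M i j
  proof -
    have d [simp]: "dim_row (M k) = m" "dim_col (M k) = m" for k using carrier_matD[OF that(5)[of k]] by auto
    have "commutator Y Z $$ (i, j) = (\<Sum>q<m. Y $$ (i, q) * Z $$ (q, j)) - (\<Sum>q<m. Z $$ (i, q) * Y $$ (q, j))"
      using that carrier_matD[OF that(3)] carrier_matD[OF that(4)]
      by (simp add: commutator_def scalar_prod_def lessThan_atLeast0)
    also have "\<dots> = (\<Sum>q<m. \<Sum>k<r. w k * (M k $$ (i, q) * Z $$ (q, j))) - (\<Sum>q<m. \<Sum>k<r. w k * (Z $$ (i, q) * M k $$ (q, j)))"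
      using that(1,2) by (simp add: Y sum_distrib_left sum_distrib_right mult_ac)
    also have "\<dots> = (\<Sum>k<r. w k * ((\<Sum>q<m. M k $$ (i, q) * Z $$ (q, j)) - (\<Sum>q<m. Z $$ (i, q) * M k $$ (q, j))))"
      by (subst (1 2) sum.swap) (simp add: sum_subtractf sum_distrib_left right_diff_distrib)
    also have "\<dots> = (\<Sum>k<r. w k * commutator (M k) Z $$ (i, j))"
      using that carrier_matD[OF that(4)]
      by (simp add: commutator_def scalar_prod_def lessThan_atLeast0)
    finally show ?thesis .
  qed
  \<comment> \<open>Commuting with \<open>A\<close> is linear, so the relation for
    \<open>K r\<close> carries over to all shifts.\<close>
  have rec: "K (r + s) $$ (i, j) = (\<Sum>k<r. w k * K (k + s) $$ (i, j))" if "i < m" "j < m" for s i j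
    using that
  proof (induction s arbitrary: i j)
    case 0
    have "i * m + j < Suc i * m" using 0 by simp
    also have "\<dots> \<le> m * m" using 0 by (intro mult_le_mono1) simp
    finally have "i * m + j < m\<^sup>2" by (simp add: power2_eq_square)
    from w[OF this] 0 show ?case by simp
  next
    case (Suc s)
    show ?case using com[OF Suc.prems, of "K (r + s)" A "\<lambda>k. K (k + s)"] Suc.IH by (simp add: K_Suc)
  qed
  have "commutator (K k) X = 0\<^sub>m m m"
  proof (induction k rule: less_induct)
    case (less k)
    show ?case
    proof (cases "k < r")
      case True
      with r vanish[of k] show ?thesis by (simp add: iterated_commutator_snoc K_def)
    next
      case False
      then obtain s where s: "k = r + s" by (metis le_add_diff_inverse not_less)
      show ?thesis
      proof (rule eq_matI)
        fix i j assume "i < dim_row (0\<^sub>m m m)" "j < dim_col (0\<^sub>m m m)"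
        then have ij: "i < m" "j < m" by auto
        have "commutator (K k) X $$ (i, j) = (\<Sum>p<r. w p * commutator (K (p + s)) X $$ (i, j))"
          unfolding s by (rule com[OF ij]) (auto intro: rec)
        also have "\<dots> = 0"
          using less.IH ij by (intro sum.neutral) (simp add: s)
        finally show "commutator (K k) X $$ (i, j) = 0\<^sub>m m m $$ (i, j)" using ij by simp
      qed (use carrier_matD[OF commutator_carrier[OF K assms(3)]] in auto)
    qed
  qed
  then show ?thesis by (simp add: iterated_commutator_snoc K_def)
qed

subsection \<open>Flows of the Sylvester operator\<close>

text \<open>In contrast to \<open>has_mat_deriv\<close> the derivative is two-sided, at a single
  point, and over any real normed field, which covers complex Jordan coordinates.\<close>

definition has_mat_derivative_at :: "nat \<Rightarrow> (real \<Rightarrow> 'a :: real_normed_field mat) \<Rightarrow> 'a mat \<Rightarrow> real \<Rightarrow> bool" where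
  "has_mat_derivative_at n F F' t \<longleftrightarrow> (\<forall>s. F s \<in> carrier_mat n n) \<and> F' \<in> carrier_mat n n \<and>
    (\<forall>i<n. \<forall>j<n. ((\<lambda>s. F s $$ (i, j)) has_vector_derivative F' $$ (i, j)) (at t))"

lemma has_mat_derivative_at_carrierD:
  "has_mat_derivative_at n F F' t \<Longrightarrow> F s \<in> carrier_mat n n"
  "has_mat_derivative_at n F F' t \<Longrightarrow> F' \<in> carrier_mat n n"
  by (auto simp: has_mat_derivative_at_def)

lemma has_mat_derivative_at_mult_left:
  assumes F: "has_mat_derivative_at n F F' t" and P: "P \<in> carrier_mat n n"
  shows "has_mat_derivative_at n (\<lambda>s. P * F s) (P * F') t"
  unfolding has_mat_derivative_at_def
proof (intro conjI allI impI)
  note c = has_mat_derivative_at_carrierD[OF F]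
  show "P * F s \<in> carrier_mat n n" "P * F' \<in> carrier_mat n n" for s
    using c P by (auto intro: mult_carrier_mat)
  fix i j assume ij: "i < n" "j < n"
  have e: "(P * X) $$ (i, j) = (\<Sum>k<n. P $$ (i, k) * X $$ (k, j))" if "X \<in> carrier_mat n n" for X
    using that ij P by (auto simp: scalar_prod_def lessThan_atLeast0)
  show "((\<lambda>s. (P * F s) $$ (i, j)) has_vector_derivative (P * F') $$ (i, j)) (at t)"
    unfolding e[OF c(1)] e[OF c(2)]
    by (intro has_vector_derivative_sum has_vector_derivative_mult_right)
      (use F ij in \<open>auto simp: has_mat_derivative_at_def\<close>)
qed

lemma has_mat_derivative_at_mult_right:
  assumes F: "has_mat_derivative_at n F F' t" and P: "P \<in> carrier_mat n n"
  shows "has_mat_derivative_at n (\<lambda>s. F s * P) (F' * P) t"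
  unfolding has_mat_derivative_at_def
proof (intro conjI allI impI)
  note c = has_mat_derivative_at_carrierD[OF F]
  show "F s * P \<in> carrier_mat n n" "F' * P \<in> carrier_mat n n" for s
    using c P by (auto intro: mult_carrier_mat)
  fix i j assume ij: "i < n" "j < n"
  have e: "(X * P) $$ (i, j) = (\<Sum>k<n. X $$ (i, k) * P $$ (k, j))" if "X \<in> carrier_mat n n" for X
    using that ij P by (auto simp: scalar_prod_def lessThan_atLeast0)
  show "((\<lambda>s. (F s * P) $$ (i, j)) has_vector_derivative (F' * P) $$ (i, j)) (at t)"
    unfolding e[OF c(1)] e[OF c(2)]
    by (intro has_vector_derivative_sum has_vector_derivative_mult_left)
      (use F ij in \<open>auto simp: has_mat_derivative_at_def\<close>)
qed

lemma sylvester_index: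
  assumes "A \<in> carrier_mat n n" "V \<in> carrier_mat n n" "X \<in> carrier_mat n n" "i < n" "j < n"
  shows "sylvester A V X $$ (i, j) = ((X * V) $$ (i, j) - (A * X) $$ (i, j)) / 2"
  using assms by (simp add: sylvester_def del: index_mult_mat(1))

lemma has_mat_derivative_at_sylvester:
  assumes F: "has_mat_derivative_at n F F' t" and AV: "A \<in> carrier_mat n n" "V \<in> carrier_mat n n"
  shows "has_mat_derivative_at n (\<lambda>s. sylvester A V (F s)) (sylvester A V F') t"
proof -
  note c = has_mat_derivative_at_carrierD[OF F]
  show ?thesis
    using has_mat_derivative_at_mult_left[OF F AV(1)] has_mat_derivative_at_mult_right[OF F AV(2)] c AV
    unfolding has_mat_derivative_at_def
    by (auto simp: sylvester_index[OF AV] simp del: index_mult_mat(1) intro!: has_vector_derivative_divide has_vector_derivative_diff)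
qed

text \<open>The bound \<open>d\<close> controls the growth of all iterates of the operator, and with
  it the Taylor remainders of its flow.\<close>

lemma norm_bound_sylvester:
  fixes A V :: "'a :: real_normed_field mat"
  assumes A: "A \<in> carrier_mat n n" and V: "V \<in> carrier_mat n n"
  obtains d where "\<And>X K. X \<in> carrier_mat n n \<Longrightarrow> norm_bound X K \<Longrightarrow> norm_bound (sylvester A V X) (K * d)"
proof -
  obtain a v where av: "norm_bound A a" "norm_bound V v" using norm_bound_max by blast
  have "norm_bound (sylvester A V X) (K * ((v * n + a * n) / 2))" if X: "X \<in> carrier_mat n n" and K: "norm_bound X K" for X K
  proof (rule norm_boundI)
    fix i j assume "i < dim_row (sylvester A V X)" "j < dim_col (sylvester A V X)"
    then have ij: "i < n" "j < n" using A V X by (auto simp: sylvester_def)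
    have "norm ((X * V) $$ (i, j)) \<le> K * v * n" "norm ((A * X) $$ (i, j)) \<le> a * K * n"
      using norm_bound_mult[OF X V K av(2)] norm_bound_mult[OF A X av(1) K] ij A V X
      by (auto simp: norm_bound_def simp del: index_mult_mat(1))
    then have "norm ((X * V) $$ (i, j) - (A * X) $$ (i, j)) \<le> K * v * n + a * K * n"
      by (intro order.trans[OF norm_triangle_ineq4] add_mono)
    then show "norm (sylvester A V X $$ (i, j)) \<le> K * ((v * n + a * n) / 2)"
      unfolding sylvester_index[OF A V X ij] norm_divide by (simp add: algebra_simps)
  qed
  then show ?thesis by (rule that)
qed

text \<open>All derivatives of \<open>F\<close> are iterates of the Sylvester operator on \<open>F\<close>, so a linear functional
  which vanishes on the iterates at \<open>0\<close> vanishes along \<open>F\<close> by Taylor's theorem.\<close>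

lemma sylvester_flow_flat:
  fixes F :: "real \<Rightarrow> 'a :: real_normed_field mat" and p :: "'a mat \<Rightarrow> real"
  assumes A: "A \<in> carrier_mat n n" and V: "V \<in> carrier_mat n n"
    and F: "\<And>t. has_mat_derivative_at n F (sylvester A V (F t)) t"
    and K: "\<And>t. norm_bound (F t) K"
    and p: "\<And>G G' t. has_mat_derivative_at n G G' t \<Longrightarrow> ((\<lambda>s. p (G s)) has_real_derivative p G') (at t)"
    and bound: "\<And>X b. X \<in> carrier_mat n n \<Longrightarrow> norm_bound X b \<Longrightarrow> \<bar>p X\<bar> \<le> b * c"
    and flat: "\<And>k. p ((sylvester A V ^^ k) (F 0)) = 0"
  shows "p (F t) = 0"
proof -
  obtain d where d: "\<And>X K. X \<in> carrier_mat n n \<Longrightarrow> norm_bound X K \<Longrightarrow> norm_bound (sylvester A V X) (K * d)"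
    using norm_bound_sylvester[OF A V] by blast
  have c: "F t \<in> carrier_mat n n" for t using has_mat_derivative_at_carrierD(1)[OF F] .
  have der: "has_mat_derivative_at n (\<lambda>s. (sylvester A V ^^ k) (F s)) ((sylvester A V ^^ Suc k) (F t)) t" for k t
  proof (induction k)
    case 0
    show ?case using F[of t] by simp
  next
    case (Suc k)
    from has_mat_derivative_at_sylvester[OF Suc A V] show ?case by simp
  qed
  have nb: "norm_bound ((sylvester A V ^^ k) (F t)) (K * d ^ k)" for k t
  proof (induction k)
    case (Suc k)
    from d[OF _ Suc] A V c show ?case by (simp add: mult_ac)
  qed (use K in simp)
  define D where "D k t = p ((sylvester A V ^^ k) (F t))" for k t
  have "D 0 t = 0"
  proof (rule flat_at_0_imp_zero[of D "K * c" d])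
    show "(D k has_real_derivative D (Suc k) t) (at t)" for k t
      unfolding D_def by (rule p[OF der])
    show "\<bar>D k t\<bar> \<le> K * c * d ^ k" for k t
      using bound[OF _ nb[of k t]] A V c by (simp add: D_def mult_ac)
    show "D k 0 = 0" for k unfolding D_def by (rule flat)
  qed
  then show ?thesis by (simp add: D_def)
qed

section \<open>The explicit flow in Jordan coordinates and its transport back\<close>

lemma det_bidiag_mat: "det (bidiag_mat n l e) = (\<Prod>i<n. l i :: 'a :: comm_ring_1)"
proof -
  have "det (bidiag_mat n l e) = prod_list (diag_mat (bidiag_mat n l e))"
    by (rule det_upper_triangular[of _ n]) (auto simp: bidiag_mat_def)
  also have "\<dots> = (\<Prod>i<n. l i)"
    by (subst prod_list_diag_prod) (auto simp: bidiag_mat_def lessThan_atLeast0)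
  finally show ?thesis .
qed

text \<open>As \<open>X\<close> intertwines the real parts, these cancel from the Sylvester
  operator, and the imaginary parts merely rotate each entry.\<close>

lemma jordan_coordinates_flow:
  fixes X :: "complex mat" and l e l' e' :: "nat \<Rightarrow> complex"
  assumes l: "constant_on_couplings n l e" and l': "constant_on_couplings n l' e'"
    and X: "X \<in> carrier_mat n n"
    and eq: "bidiag_mat n (\<lambda>i. of_real (Re (l i))) e * X = X * bidiag_mat n (\<lambda>i. of_real (Re (l' i))) e'"
  obtains E where "E 0 = X" "\<And>t. has_mat_derivative_at n E (sylvester (bidiag_mat n l e) (bidiag_mat n l' e') (E t)) t"
    "\<And>t. norm (det (E t)) = norm (det X)" "\<And>t K. norm_bound X K \<Longrightarrow> norm_bound (E t) K"
proof -
  \<comment> \<open>The sign is opposite to that in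
    \<open>bounded_intertwiner_real_part_tendsto_0\<close>: the phase is put in here, not
    removed.\<close>
  define w where "w i j = (Im (l' j) - Im (l i)) / 2" for i j
  define E where "E t = mat n n (\<lambda>(i, j). cis (w i j * t) * X $$ (i, j))" for t
  let ?J = "bidiag_mat n l e" and ?J' = "bidiag_mat n l' e'"
  have E: "E t \<in> carrier_mat n n" for t by (simp add: E_def)
  have "has_mat_derivative_at n E (sylvester ?J ?J' (E t)) t" for t
    unfolding has_mat_derivative_at_def
  proof (intro conjI allI impI)
    fix i j assume ij: "i < n" "j < n"
    have a: "E t $$ (i, j - 1) * e' (j - 1) = cis (w i j * t) * (X $$ (i, j - 1) * e' (j - 1))" if "j > 0"
      using constant_on_couplingsD[OF l', of "j - 1"] that ij
      by (cases "e' (j - 1) = 0") (auto simp: E_def w_def)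
    have b: "e i * E t $$ (Suc i, j) = cis (w i j * t) * (e i * X $$ (Suc i, j))" if "Suc i < n"
      using constant_on_couplingsD[OF l that] that ij
      by (cases "e i = 0") (auto simp: E_def w_def)
    let ?x = "if j > 0 then X $$ (i, j - 1) * e' (j - 1) else 0"
    let ?y = "if Suc i < n then e i * X $$ (Suc i, j) else 0"
    have "of_real (Re (l i)) * X $$ (i, j) + ?y = X $$ (i, j) * of_real (Re (l' j)) + ?x"
      using arg_cong[OF eq, of "\<lambda>M. M $$ (i, j)"]
      unfolding bidiag_mat_mult_index[OF X ij] mult_bidiag_mat_index[OF X ij] .
    \<comment> \<open>The intertwining relation trades the coupling terms for a diagonal term, which
      cancels the real parts of the eigenvalues.\<close>
    then have xy: "?x - ?y = (of_real (Re (l i)) - of_real (Re (l' j))) * X $$ (i, j)"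
      by (simp add: algebra_simps)
    have "(E t * ?J') $$ (i, j) - (?J * E t) $$ (i, j)
      = (l' j - l i) * E t $$ (i, j) + ((if j > 0 then E t $$ (i, j - 1) * e' (j - 1) else 0)
        - (if Suc i < n then e i * E t $$ (Suc i, j) else 0))"
      unfolding bidiag_mat_mult_index[OF E ij] mult_bidiag_mat_index[OF E ij] by (simp add: algebra_simps)
    also have "\<dots> = (l' j - l i) * E t $$ (i, j) + cis (w i j * t) * (?x - ?y)"
      by (cases "j > 0"; cases "Suc i < n") (simp_all only: a b if_True if_False, simp_all add: algebra_simps)
    also have "\<dots> = cis (w i j * t) * X $$ (i, j) * ((l' j - of_real (Re (l' j))) - (l i - of_real (Re (l i))))"
      unfolding xy using ij by (simp add: E_def algebra_simps)
    also have "(l' j - of_real (Re (l' j))) - (l i - of_real (Re (l i))) = 2 * (\<i> * of_real (w i j))"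
      by (simp add: complex_eq_iff w_def)
    finally have *: "(E t * ?J') $$ (i, j) - (?J * E t) $$ (i, j) = 2 * (\<i> * of_real (w i j) * cis (w i j * t) * X $$ (i, j))"
      by simp
    have "((\<lambda>s. cis (w i j * s) * X $$ (i, j)) has_vector_derivative \<i> * of_real (w i j) * cis (w i j * t) * X $$ (i, j)) (at t)"
      by (intro has_vector_derivative_mult_left has_vector_derivative_cis)
    moreover have "sylvester ?J ?J' (E t) $$ (i, j) = \<i> * of_real (w i j) * cis (w i j * t) * X $$ (i, j)"
      unfolding sylvester_index[OF bidiag_mat_carrier bidiag_mat_carrier E ij] * by simp
    ultimately show "((\<lambda>s. E s $$ (i, j)) has_vector_derivative sylvester ?J ?J' (E t) $$ (i, j)) (at t)"
      using ij by (simp add: E_def)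
  qed (use E in auto)
  moreover have "norm (det (E t)) = norm (det X)" for t
  proof -
    let ?D = "bidiag_mat n (\<lambda>i. cis (- (Im (l i) / 2 * t))) (\<lambda>_. 0)"
    let ?D' = "bidiag_mat n (\<lambda>i. cis (Im (l' i) / 2 * t)) (\<lambda>_. 0)"
    have DX: "?D * X \<in> carrier_mat n n" using X by (intro mult_carrier_mat[of _ n n]) auto
    \<comment> \<open>The phase splits into a row factor and a column factor, so \<open>E t\<close>
      differs from \<open>X\<close> by diagonal matrices with unimodular determinant.\<close>
    have "E t = ?D * X * ?D'"
    proof (rule eq_matI)
      fix i j assume "i < dim_row (?D * X * ?D')" "j < dim_col (?D * X * ?D')"
      then have ij: "i < n" "j < n" by auto
      have cw: "cis (- (Im (l i) / 2 * t)) * cis (Im (l' j) / 2 * t) = cis (w i j * t)"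
        by (simp add: cis_mult w_def field_simps)
      have "(?D * X * ?D') $$ (i, j) = (cis (- (Im (l i) / 2 * t)) * cis (Im (l' j) / 2 * t)) * X $$ (i, j)"
        unfolding mult_bidiag_mat_index[OF DX ij] bidiag_mat_mult_index[OF X ij] by (simp add: mult_ac)
      then show "E t $$ (i, j) = (?D * X * ?D') $$ (i, j)"
        unfolding cw using ij by (simp add: E_def)
    qed (use E[of t] in auto)
    then have "det (E t) = det ?D * det X * det ?D'"
      using X DX by (simp add: det_mult[of _ n])
    then show ?thesis by (simp add: det_bidiag_mat norm_mult flip: prod_norm)
  qed
  moreover have "norm_bound (E t) K" if "norm_bound X K" for t K
    using that X by (auto simp: norm_bound_def E_def norm_mult)
  moreover have "E 0 = X" using X by (auto simp: E_def)
  ultimately show ?thesis by (intro that)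
qed

lemma map_of_real_sylvester:
  fixes A V Y :: "real mat"
  assumes A: "A \<in> carrier_mat n n" and V: "V \<in> carrier_mat n n" and Y: "Y \<in> carrier_mat n n"
  shows "map_mat complex_of_real (sylvester A V Y) =
    sylvester (map_mat of_real A) (map_mat of_real V) (map_mat of_real Y)"
  using assms carrier_matD[OF A] carrier_matD[OF V] carrier_matD[OF Y]
  by (intro eq_matI)
    (auto simp: sylvester_def of_real_hom.mat_hom_mult[of _ n n _ n, symmetric] simp del: index_mult_mat(1))

text \<open>The flow is built in complex Jordan coordinates and transported back by \<open>T\<close>
  and \<open>S'\<close>. It is real by the Taylor argument, because all its derivatives at 0 are
  images of the real matrix \<open>C\<close> under a real operator.\<close>

lemma bounded_sylvester_flow_exists:
  fixes A V C :: "real mat"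
  assumes A: "A \<in> carrier_mat n n" and V: "V \<in> carrier_mat n n" and C: "C \<in> carrier_mat n n"
    and eq: "real_part_mat A * C = C * real_part_mat V"
  obtains L K where "L 0 = C" "\<And>t. has_mat_derivative_at n L (sylvester A V (L t)) t"
    "\<And>t. norm_bound (L t) K" "\<And>t. \<bar>det (L t)\<bar> = \<bar>det C\<bar>"
proof -
  let ?c = "map_mat complex_of_real"
  from real_part_mat_bidiagE[OF A] obtain T S l e where
    T [simp]: "T \<in> carrier_mat n n" "S \<in> carrier_mat n n" and TS: "T * S = 1\<^sub>m n" "S * T = 1\<^sub>m n"
    and l: "constant_on_couplings n l e"
    and AJ: "?c A = T * bidiag_mat n l e * S"
    and AR: "?c (real_part_mat A) = T * bidiag_mat n (\<lambda>i. complex_of_real (Re (l i))) e * S"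
    and ARc: "real_part_mat A \<in> carrier_mat n n" by metis
  from real_part_mat_bidiagE[OF V] obtain T' S' l' e' where
    T' [simp]: "T' \<in> carrier_mat n n" "S' \<in> carrier_mat n n" and TS': "T' * S' = 1\<^sub>m n" "S' * T' = 1\<^sub>m n"
    and l': "constant_on_couplings n l' e'"
    and VJ: "?c V = T' * bidiag_mat n l' e' * S'"
    and VR: "?c (real_part_mat V) = T' * bidiag_mat n (\<lambda>i. complex_of_real (Re (l' i))) e' * S'"
    and VRc: "real_part_mat V \<in> carrier_mat n n" by metis
  note ac = square_mat_simps[where n = n]
  have assoc: "X * (Y * Z) = (X * Y) * Z" if "X \<in> carrier_mat n n" "Y \<in> carrier_mat n n" "Z \<in> carrier_mat n n" for X Y Z :: "complex mat"
    using that by simp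
  have cancel: "S * (T * X) = X" "T * (S * X) = X" "S' * (T' * X) = X" "T' * (S' * X) = X" if "X \<in> carrier_mat n n" for X
    using that TS TS' by (simp_all add: ac assoc)
  let ?J = "bidiag_mat n l e" and ?J' = "bidiag_mat n l' e'"
  let ?R = "bidiag_mat n (\<lambda>i. complex_of_real (Re (l i))) e" and ?R' = "bidiag_mat n (\<lambda>i. complex_of_real (Re (l' i))) e'"
  note [simp] = A V C
  define X where "X = S * ?c C * T'"
  have X [simp]: "X \<in> carrier_mat n n" by (simp add: X_def ac)
  have "?c (real_part_mat A) * ?c C = ?c C * ?c (real_part_mat V)"
    using arg_cong[OF eq, of ?c] A C V ARc VRc by (simp add: of_real_hom.mat_hom_mult[of _ n n _ n])
  then have "S * (T * ?R * S * ?c C) * T' = S * (?c C * (T' * ?R' * S')) * T'" unfolding AR VR by simp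
  then have "?R * X = X * ?R'" by (simp add: X_def ac cancel TS')
  from jordan_coordinates_flow[OF l l' X this] obtain E where
    E0: "E 0 = X" and E: "\<And>t. has_mat_derivative_at n E (sylvester ?J ?J' (E t)) t"
    and detE: "\<And>t. norm (det (E t)) = norm (det X)" and EK: "\<And>t K. norm_bound X K \<Longrightarrow> norm_bound (E t) K"
    by metis
  have Ec [simp]: "E t \<in> carrier_mat n n" for t using has_mat_derivative_at_carrierD(1)[OF E] .
  define F where "F t = T * E t * S'" for t
  have Fc [simp]: "F t \<in> carrier_mat n n" for t by (simp add: F_def ac)
  have F: "has_mat_derivative_at n F (sylvester (?c A) (?c V) (F t)) t" for t
  proof -
    have "has_mat_derivative_at n F (T * sylvester ?J ?J' (E t) * S') t"
      unfolding F_def by (intro has_mat_derivative_at_mult_left has_mat_derivative_at_mult_right E T T')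
    also have "T * sylvester ?J ?J' (E t) * S' = sylvester (?c A) (?c V) (F t)"
      unfolding sylvester_def AJ VJ F_def by (simp add: ac cancel)
    finally show ?thesis .
  qed
  have F0: "F 0 = ?c C" unfolding F_def E0 X_def by (simp add: ac cancel TS')
  have detF: "norm (det (F t)) = \<bar>det C\<bar>" for t
  proof -
    have d1: "norm (det T) * norm (det S) = 1" "norm (det T') * norm (det S') = 1"
      using arg_cong[OF TS(1), of det] arg_cong[OF TS'(1), of det]
      by (simp_all add: det_mult[of _ n] flip: norm_mult)
    have "norm (det (F t)) = norm (det T) * norm (det X) * norm (det S')"
      by (simp add: F_def ac det_mult[of _ n] norm_mult detE)
    also have "\<dots> = (norm (det T) * norm (det S)) * norm (det (?c C)) * (norm (det T') * norm (det S'))"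
      by (simp add: X_def ac det_mult[of _ n] norm_mult)
    finally show ?thesis unfolding d1 using C by simp
  qed
  obtain x t s where "norm_bound X x" "norm_bound T t" "norm_bound S' s" using norm_bound_max by blast
  then have FK: "norm_bound (F r) (t * x * n * s * n)" for r
    unfolding F_def by (intro norm_bound_mult[of _ n n _ n] EK) (auto simp: ac)
  have Ac: "?c A \<in> carrier_mat n n" "?c V \<in> carrier_mat n n" using A V by auto
  have sylc: "sylvester (?c A) (?c V) (?c Y) = ?c (sylvester A V Y)" if "Y \<in> carrier_mat n n" for Y
    using map_of_real_sylvester[OF A V that] by simp
  have Fim: "Im (F t $$ (i, j)) = 0" if ij: "i < n" "j < n" for t i j
  proof (rule sylvester_flow_flat[OF Ac F FK, of "\<lambda>Y. Im (Y $$ (i, j))" 1])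
    show "((\<lambda>s. Im (G s $$ (i, j))) has_real_derivative Im (G' $$ (i, j))) (at r)"
      if "has_mat_derivative_at n G G' r" for G G' r
      using that ij bounded_linear.has_vector_derivative[OF bounded_linear_Im]
      by (auto simp: has_mat_derivative_at_def has_real_derivative_iff_has_vector_derivative)
    show "\<bar>Im (Y $$ (i, j))\<bar> \<le> b * 1" if "Y \<in> carrier_mat n n" "norm_bound Y b" for Y b
      using that ij abs_Im_le_cmod[of "Y $$ (i, j)"] by (force simp: norm_bound_def)
    have "(sylvester (?c A) (?c V) ^^ k) (?c C) = ?c ((sylvester A V ^^ k) C)" for k
      by (induction k) (use A V C in \<open>auto simp: sylc\<close>)
    then show "Im ((sylvester (?c A) (?c V) ^^ k) (F 0) $$ (i, j)) = 0" for k
      unfolding F0 using ij carrier_matD[OF funpow_sylvester_carrier[OF A V C]] by simp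
  qed
  define L where "L t = map_mat Re (F t)" for t
  have FL: "F t = ?c (L t)" for t
    using Fim[of _ _ t] carrier_matD[OF Fc[of t]] by (intro eq_matI) (auto simp: L_def complex_eq_iff)
  have Lc: "L t \<in> carrier_mat n n" for t using Fc[of t] by (simp add: L_def)
  show ?thesis
  proof (rule that)
    show "L 0 = C" unfolding L_def F0 by (rule eq_matI) auto
    show "norm_bound (L r) (t * x * n * s * n)" for r
      using FK[of r] unfolding FL by (auto simp: norm_bound_def)
    show "\<bar>det (L t)\<bar> = \<bar>det C\<bar>" for t
      using detF[of t] unfolding FL by simp
    show "has_mat_derivative_at n L (sylvester A V (L t)) t" for t
      unfolding has_mat_derivative_at_def
    proof (intro conjI allI impI)
      fix i j assume ij: "i < n" "j < n"
      have "((\<lambda>s. F s $$ (i, j)) has_vector_derivative ?c (sylvester A V (L t)) $$ (i, j)) (at t)"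
        using F[of t] ij unfolding has_mat_derivative_at_def by (auto simp: FL sylc Lc)
      from bounded_linear.has_vector_derivative[OF bounded_linear_Re this]
      show "((\<lambda>s. L s $$ (i, j)) has_vector_derivative sylvester A V (L t) $$ (i, j)) (at t)"
        using ij carrier_matD[OF Lc] carrier_matD[OF sylvester_carrier[OF A V Lc]] by (simp add: FL)
    qed (use Lc A V in auto)
  qed
qed

subsection \<open>Limits of bounded flows\<close>

lemma tendsto_mat_mult_index:
  fixes P C :: "'a :: real_normed_field mat"
  assumes F: "\<And>k. F k \<in> carrier_mat n n" and C: "C \<in> carrier_mat n n" and P: "P \<in> carrier_mat n n"
    and lim: "\<And>i j. i < n \<Longrightarrow> j < n \<Longrightarrow> ((\<lambda>k. F k $$ (i, j)) \<longlongrightarrow> C $$ (i, j)) net"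
    and ij: "i < n" "j < n"
  shows "((\<lambda>k. (P * F k) $$ (i, j)) \<longlongrightarrow> (P * C) $$ (i, j)) net"
    and "((\<lambda>k. (F k * P) $$ (i, j)) \<longlongrightarrow> (C * P) $$ (i, j)) net"
proof -
  have e: "(P * X) $$ (i, j) = (\<Sum>k<n. P $$ (i, k) * X $$ (k, j))"
    "(X * P) $$ (i, j) = (\<Sum>k<n. X $$ (i, k) * P $$ (k, j))" if "X \<in> carrier_mat n n" for X
    using that ij P by (auto simp: scalar_prod_def lessThan_atLeast0)
  show "((\<lambda>k. (P * F k) $$ (i, j)) \<longlongrightarrow> (P * C) $$ (i, j)) net"
    unfolding e(1)[OF F] e(1)[OF C] by (intro tendsto_sum tendsto_mult tendsto_const lim ij) auto
  show "((\<lambda>k. (F k * P) $$ (i, j)) \<longlongrightarrow> (C * P) $$ (i, j)) net"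
    unfolding e(2)[OF F] e(2)[OF C] by (intro tendsto_sum tendsto_mult tendsto_const lim ij) auto
qed

lemma tendsto_det:
  fixes C :: "'a :: real_normed_field mat"
  assumes F: "\<And>k. F k \<in> carrier_mat n n" and C: "C \<in> carrier_mat n n"
    and lim: "\<And>i j. i < n \<Longrightarrow> j < n \<Longrightarrow> ((\<lambda>k. F k $$ (i, j)) \<longlongrightarrow> C $$ (i, j)) net"
  shows "((\<lambda>k. det (F k)) \<longlongrightarrow> det C) net"
  unfolding det_def'[OF F] det_def'[OF C]
  by (intro tendsto_sum tendsto_mult tendsto_const tendsto_prod lim) (auto simp: permutes_in_image)

lemma limit_intertwines:
  fixes C P P' :: "'a :: real_normed_field mat"
  assumes F: "\<And>k. F k \<in> carrier_mat n n" and C: "C \<in> carrier_mat n n"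
    and P: "P \<in> carrier_mat n n" "P' \<in> carrier_mat n n" and net: "net \<noteq> bot"
    and lim: "\<And>i j. i < n \<Longrightarrow> j < n \<Longrightarrow> ((\<lambda>k. F k $$ (i, j)) \<longlongrightarrow> C $$ (i, j)) net"
    and zero: "\<And>i j. i < n \<Longrightarrow> j < n \<Longrightarrow> ((\<lambda>k. (P * F k - F k * P') $$ (i, j)) \<longlongrightarrow> 0) net"
  shows "P * C = C * P'"
proof (rule eq_matI)
  fix i j assume "i < dim_row (C * P')" "j < dim_col (C * P')"
  then have ij: "i < n" "j < n" using C P by auto
  have "((\<lambda>k. (P * F k) $$ (i, j) - (F k * P') $$ (i, j)) \<longlongrightarrow> (P * C) $$ (i, j) - (C * P') $$ (i, j)) net"
    by (intro tendsto_diff tendsto_mat_mult_index[OF F C _ lim ij] P)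
  moreover have "(P * F k) $$ (i, j) - (F k * P') $$ (i, j) = (P * F k - F k * P') $$ (i, j)" for k
    using carrier_matD[OF F[of k]] P ij by (simp del: index_mult_mat(1))
  ultimately have "(P * C) $$ (i, j) - (C * P') $$ (i, j) = 0"
    by (intro tendsto_unique[OF net _ zero[OF ij]]) simp
  then show "(P * C) $$ (i, j) = (C * P') $$ (i, j)" by simp
qed (use C P in auto)

text \<open>In the Jordan coordinates \<open>S * L t * T'\<close> this is
  \<open>bounded_intertwiner_real_part_tendsto_0\<close>; multiplying that limit by \<open>T\<close>
  and \<open>S'\<close> returns to \<open>L\<close>.\<close>

lemma bounded_sylvester_flow_asymptotic:
  fixes A V :: "real mat"
  assumes A: "A \<in> carrier_mat n n" and V: "V \<in> carrier_mat n n"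
    and L: "\<And>t. t > 0 \<Longrightarrow> has_mat_derivative_at n L (sylvester A V (L t)) t"
    and K: "\<And>t. t > 0 \<Longrightarrow> norm_bound (L t) K" and ij: "i < n" "j < n"
  shows "((\<lambda>t. (real_part_mat A * L t - L t * real_part_mat V) $$ (i, j)) \<longlongrightarrow> 0) at_top"
proof -
  let ?c = "map_mat complex_of_real"
  note [simp] = A V
  have Lc [simp]: "L t \<in> carrier_mat n n" for t
    using has_mat_derivative_at_carrierD(1)[OF L[of 1]] by simp
  from real_part_mat_bidiagE[OF A] obtain T S l e where
    T [simp]: "T \<in> carrier_mat n n" "S \<in> carrier_mat n n" and TS: "T * S = 1\<^sub>m n" "S * T = 1\<^sub>m n"
    and l: "constant_on_couplings n l e"
    and AJ: "?c A = T * bidiag_mat n l e * S"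
    and AR: "?c (real_part_mat A) = T * bidiag_mat n (\<lambda>i. complex_of_real (Re (l i))) e * S"
    and ARc [simp]: "real_part_mat A \<in> carrier_mat n n" by metis
  from real_part_mat_bidiagE[OF V] obtain T' S' l' e' where
    T' [simp]: "T' \<in> carrier_mat n n" "S' \<in> carrier_mat n n" and TS': "T' * S' = 1\<^sub>m n" "S' * T' = 1\<^sub>m n"
    and l': "constant_on_couplings n l' e'"
    and VJ: "?c V = T' * bidiag_mat n l' e' * S'"
    and VR: "?c (real_part_mat V) = T' * bidiag_mat n (\<lambda>i. complex_of_real (Re (l' i))) e' * S'"
    and VRc [simp]: "real_part_mat V \<in> carrier_mat n n" by metis
  note ac = square_mat_simps[where n = n]
  have assoc: "X * (Y * Z) = (X * Y) * Z" if "X \<in> carrier_mat n n" "Y \<in> carrier_mat n n" "Z \<in> carrier_mat n n" for X Y Z :: "complex mat"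
    using that by simp
  have cancel: "S * (T * X) = X" "T * (S * X) = X" "S' * (T' * X) = X" "T' * (S' * X) = X" if "X \<in> carrier_mat n n" for X
    using that TS TS' by (simp_all add: ac assoc)
  let ?J = "bidiag_mat n l e" and ?J' = "bidiag_mat n l' e'"
  let ?R = "bidiag_mat n (\<lambda>i. complex_of_real (Re (l i))) e" and ?R' = "bidiag_mat n (\<lambda>i. complex_of_real (Re (l' i))) e'"
  define X where "X t = S * ?c (L t) * T'" for t
  have X [simp]: "X t \<in> carrier_mat n n" for t by (simp add: X_def ac)
  have sylc: "?c (sylvester A V Y) = sylvester (?c A) (?c V) (?c Y)" if "Y \<in> carrier_mat n n" for Y
    by (rule map_of_real_sylvester[OF A V that])
  have dX: "has_mat_derivative_at n X (sylvester ?J ?J' (X t)) t" if t: "t > 0" for t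
  proof -
    have "has_mat_derivative_at n (\<lambda>s. ?c (L s)) (?c (sylvester A V (L t))) t"
      using L[OF t] unfolding has_mat_derivative_at_def
      by (auto simp: carrier_matD[OF Lc] carrier_matD[OF sylvester_carrier[OF A V Lc]] simp flip: has_real_derivative_iff_has_vector_derivative
          intro!: has_vector_derivative_of_real)
    then have "has_mat_derivative_at n X (S * ?c (sylvester A V (L t)) * T') t"
      unfolding X_def by (intro has_mat_derivative_at_mult_left has_mat_derivative_at_mult_right T T')
    also have "S * ?c (sylvester A V (L t)) * T' = sylvester ?J ?J' (X t)"
      unfolding sylc[OF Lc] unfolding sylvester_def AJ VJ X_def by (simp add: ac cancel TS TS')
    finally show ?thesis .
  qed
  obtain s t' where st: "norm_bound S s" "norm_bound T' t'" using norm_bound_max by blast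
  have XK: "norm_bound (X t) (s * K * n * t' * n)" if "t > 0" for t
    unfolding X_def using K[OF that] st
    by (intro norm_bound_mult[of _ n n _ n]) (auto simp: ac norm_bound_def)
  let ?D = "\<lambda>t. ?R * X t - X t * ?R'"
  have Dc: "?D t \<in> carrier_mat n n" for t by (simp add: ac)
  have lim: "((\<lambda>t. ?D t $$ (i, j)) \<longlongrightarrow> 0\<^sub>m n n $$ (i, j)) at_top" if ij: "i < n" "j < n" for i j
  proof -
    have "((\<lambda>t. ?D t $$ (i, j)) \<longlongrightarrow> 0) at_top"
    proof (rule bounded_intertwiner_real_part_tendsto_0[OF l l' X _ XK ij])
      fix t :: real and i j assume t: "t > 0" and ij: "i < n" "j < n"
      have "sylvester ?J ?J' (X t) $$ (i, j) = (X t * ?J' - ?J * X t) $$ (i, j) / 2"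
        using sylvester_index[OF bidiag_mat_carrier bidiag_mat_carrier X ij] ij carrier_matD[OF X]
        by (simp del: index_mult_mat(1))
      then show "((\<lambda>s. X s $$ (i, j)) has_vector_derivative (X t * ?J' - ?J * X t) $$ (i, j) / 2) (at t)"
        using dX[OF t] ij unfolding has_mat_derivative_at_def by metis
    qed
    with ij show ?thesis by simp
  qed
  have TD: "((\<lambda>t. (T * ?D t) $$ (i, j)) \<longlongrightarrow> 0\<^sub>m n n $$ (i, j)) at_top" if ij: "i < n" "j < n" for i j
    using tendsto_mat_mult_index(1)[OF Dc _ T(1) lim ij] by (simp add: right_mult_zero_mat[OF T(1)])
  have "((\<lambda>t. (T * ?D t * S') $$ (i, j)) \<longlongrightarrow> (0\<^sub>m n n * S') $$ (i, j)) at_top"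
    by (rule tendsto_mat_mult_index(2)[OF _ _ T'(2) TD ij]) (auto simp: ac Dc)
  moreover have "(T * ?D t * S') $$ (i, j) = of_real ((real_part_mat A * L t - L t * real_part_mat V) $$ (i, j))" for t
  proof -
    have "T * ?D t * S' = ?c (real_part_mat A) * ?c (L t) - ?c (L t) * ?c (real_part_mat V)"
      unfolding AR VR X_def by (simp add: ac cancel TS TS')
    also have "\<dots> = ?c (real_part_mat A * L t - L t * real_part_mat V)"
      by (rule eq_matI) (auto simp: carrier_matD[OF Lc] carrier_matD[OF ARc] carrier_matD[OF VRc]
        of_real_hom.mat_hom_mult[of _ n n _ n, symmetric] simp del: index_mult_mat(1))
    finally show ?thesis using ij by (simp add: carrier_matD[OF Lc] carrier_matD[OF ARc] carrier_matD[OF VRc] del: index_mult_mat(1) index_minus_mat(1))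
  qed
  ultimately have "((\<lambda>t. complex_of_real ((real_part_mat A * L t - L t * real_part_mat V) $$ (i, j))) \<longlongrightarrow> of_real 0) at_top"
    using ij by (simp add: left_mult_zero_mat[OF T'(2)])
  then show ?thesis by (simp only: tendsto_of_real_iff)
qed

section \<open>Invertibility, conjugated commutators and limit points\<close>

lemma invertible_mat_iff_det_nonzero:
  fixes A :: "'a :: field mat"
  assumes A: "A \<in> carrier_mat n n"
  shows "invertible_mat A \<longleftrightarrow> det A \<noteq> 0"
proof
  assume "invertible_mat A"
  from mat_inv[OF A this] have "det A * det (mat_inv A) = 1"
    using det_mult[OF A, of "mat_inv A"] by simp
  then show "det A \<noteq> 0" by auto
next
  assume "det A \<noteq> 0"
  from det_non_zero_imp_unit[OF A this, of "()"] show "invertible_mat A"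
    using A unfolding Units_def ring_mat_def invertible_mat_def inverts_mat_def by fastforce
qed

text \<open>By \<open>C * G = Q * C\<close> the commutator of \<open>Q\<close> with
  \<open>C * V * mat_inv C\<close> is the conjugate of that of \<open>G\<close> with
  \<open>V\<close>. Each commutator condition of the theorem thus raises the intertwining relation
  by one level.\<close>

lemma commutator_conjugate_iff:
  fixes A C G Q V :: "'a :: field mat"
  assumes [simp]: "A \<in> carrier_mat n n" "C \<in> carrier_mat n n" "G \<in> carrier_mat n n" "Q \<in> carrier_mat n n" "V \<in> carrier_mat n n"
    and inv: "invertible_mat C" and eq: "C * G = Q * C"
  shows "commutator Q (C * V * mat_inv C - A) = 0\<^sub>m n n \<longleftrightarrow> C * commutator G V = commutator Q A * C"
proof -
  let ?I = "mat_inv C" and ?P = "C * V * mat_inv C"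
  note I = mat_inv[OF assms(2) inv]
  note [simp] = I(1)
  note ac = square_mat_simps[where n = n]
  have assoc: "X * (Y * Z) = (X * Y) * Z" if "X \<in> carrier_mat n n" "Y \<in> carrier_mat n n" "Z \<in> carrier_mat n n" for X Y Z :: "'a mat"
    using that by simp
  have cancel: "C * (?I * X) = X" "?I * (C * X) = X" if "X \<in> carrier_mat n n" for X
    using that I by (simp_all add: ac assoc)
  have P [simp]: "?P \<in> carrier_mat n n" by (simp add: ac)
  have CG: "C * (G * X) = Q * (C * X)" if "X \<in> carrier_mat n n" for X
    using that eq by (simp add: assoc)
  have "commutator Q (?P - A) = commutator Q ?P - commutator Q A"
    using carrier_matD[OF P] carrier_matD[OF assms(1)] carrier_matD[OF assms(4)]
    unfolding commutator_def mult_minus_distrib_mat[OF assms(4) P assms(1)] minus_mult_distrib_mat[OF P assms(1,4)]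
    by (intro eq_matI) (auto simp del: index_mult_mat(1))
  also have "\<dots> = 0\<^sub>m n n \<longleftrightarrow> commutator Q ?P = commutator Q A"
    using carrier_matD[OF commutator_carrier[OF assms(4) P]] carrier_matD[OF commutator_carrier[OF assms(4,1)]]
    by (auto simp: mat_eq_iff)
  also have "\<dots> \<longleftrightarrow> commutator Q ?P * C = commutator Q A * C"
  proof
    assume "commutator Q ?P * C = commutator Q A * C"
    then have "commutator Q ?P * C * ?I = commutator Q A * C * ?I" by simp
    then show "commutator Q ?P = commutator Q A" by (simp add: ac I)
  qed simp
  also have "commutator Q ?P * C = C * commutator G V"
    unfolding commutator_def by (simp add: ac cancel CG I eq[symmetric])
  finally show ?thesis .
qed

text \<open>Compactness along the times 1, 2, 3 and so on; starting at 1 keeps every time positive,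
  where the bound holds.\<close>

lemma bounded_flow_limit_point:
  fixes L :: "real \<Rightarrow> real mat"
  assumes L: "\<And>t. L t \<in> carrier_mat n n" and K: "\<And>t. t > 0 \<Longrightarrow> norm_bound (L t) K"
  obtains C \<tau> where "C \<in> carrier_mat n n" "filterlim \<tau> at_top sequentially" "\<And>k :: nat. \<tau> k > 0"
    "\<And>i j. i < n \<Longrightarrow> j < n \<Longrightarrow> (\<lambda>k. L (\<tau> k) $$ (i, j)) \<longlonglongrightarrow> C $$ (i, j)"
proof -
  have "\<exists>r :: nat \<Rightarrow> nat. strict_mono r \<and>
      (\<forall>p\<in>{..<n} \<times> {..<n}. convergent ((\<lambda>k. L (real (Suc k)) $$ p) \<circ> r))"
  proof (rule finite_family_convergent_subseq)
    show "\<bar>L (real (Suc k)) $$ p\<bar> \<le> K" if "p \<in> {..<n} \<times> {..<n}" for p k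
      using K[of "real (Suc k)"] that carrier_matD[OF L] by (auto simp: norm_bound_def)
  qed simp
  then obtain r where r: "strict_mono r"
    and conv: "\<And>i j. i < n \<Longrightarrow> j < n \<Longrightarrow> convergent (\<lambda>k. L (real (Suc (r k))) $$ (i, j))"
    by (auto simp: o_def)
  define C where "C = mat n n (\<lambda>(i, j). lim (\<lambda>k. L (real (Suc (r k))) $$ (i, j)))"
  show ?thesis
  proof (rule that)
    show "filterlim (\<lambda>k. real (Suc (r k))) at_top sequentially"
      by (intro filterlim_compose[OF filterlim_real_sequentially] filterlim_compose[OF filterlim_Suc]
          filterlim_subseq r)
    show "(\<lambda>k. L (real (Suc (r k))) $$ (i, j)) \<longlonglongrightarrow> C $$ (i, j)" if "i < n" "j < n" for i j
      using conv[OF that] that by (simp add: C_def convergent_LIMSEQ_iff)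
  qed (simp_all add: C_def)
qed

section \<open>From \<open>L_equivalent\<close> to a flow on the positive half-line\<close>

lemma has_mat_derivative_at_unique:
  fixes F G :: "real \<Rightarrow> real mat"
  assumes F: "has_mat_derivative_at n F F' t" and G: "has_mat_derivative_at n G G' t"
    and eq: "\<And>s. s > 0 \<Longrightarrow> F s = G s" and t: "t > 0"
  shows "F' = G'"
proof (rule eq_matI)
  note c = carrier_matD[OF has_mat_derivative_at_carrierD(2)[OF F]] carrier_matD[OF has_mat_derivative_at_carrierD(2)[OF G]]
  show "dim_row F' = dim_row G'" "dim_col F' = dim_col G'" using c by auto
  fix i j assume "i < dim_row G'" "j < dim_col G'"
  then have ij: "i < n" "j < n" using c by auto
  have 1: "((\<lambda>s. F s $$ (i, j)) has_real_derivative F' $$ (i, j)) (at t)"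
    and 2: "((\<lambda>s. G s $$ (i, j)) has_real_derivative G' $$ (i, j)) (at t)"
    using F G ij by (auto simp: has_mat_derivative_at_def has_real_derivative_iff_has_vector_derivative)
  have "((\<lambda>s. G s $$ (i, j)) has_real_derivative F' $$ (i, j)) (at t)"
    by (rule has_field_derivative_transform_within_open[OF 1, of "{0<..}"]) (use t eq in auto)
  from DERIV_unique[OF this 2] show "F' $$ (i, j) = G' $$ (i, j)" .
qed

text \<open>At interior points the one-sided derivative is two-sided, and \<open>G\<close> replaces
  \<open>F\<close> by a function that is square at negative times too.\<close>

lemma has_mat_deriv_imp_at:
  assumes F: "has_mat_deriv n F F'" and G: "\<And>s. G s \<in> carrier_mat n n" "\<And>s. s > 0 \<Longrightarrow> G s = F s" and t: "t > 0"
  shows "has_mat_derivative_at n G (F' t) t"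
  unfolding has_mat_derivative_at_def
proof (intro conjI allI impI G(1))
  show "F' t \<in> carrier_mat n n" using F t by (auto simp: has_mat_deriv_def)
  fix i j assume ij: "i < n" "j < n"
  have "((\<lambda>s. F s $$ (i, j)) has_real_derivative F' t $$ (i, j)) (at t within {0..})"
    using F t ij by (auto simp: has_mat_deriv_def)
  moreover have "at t within {0..} = at t"
    by (rule at_within_open_subset[of t "{0<..}"]) (use t in auto)
  ultimately have "((\<lambda>s. F s $$ (i, j)) has_real_derivative F' t $$ (i, j)) (at t)" by simp
  then have "((\<lambda>s. G s $$ (i, j)) has_real_derivative F' t $$ (i, j)) (at t)"
    by (rule has_field_derivative_transform_within_open[of _ _ _ "{0<..}"]) (use t G(2) in auto)
  then show "((\<lambda>s. G s $$ (i, j)) has_vector_derivative F' t $$ (i, j)) (at t)"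
    by (simp add: has_real_derivative_iff_has_vector_derivative)
qed

lemma mat_mult_minus_eq_iff:
  fixes X W P Y :: "'a :: comm_ring_1 mat"
  assumes "X \<in> carrier_mat n n" "W \<in> carrier_mat n n" "P \<in> carrier_mat n n" "Y \<in> carrier_mat n n"
  shows "X * (c \<cdot>\<^sub>m W - P) = Y \<longleftrightarrow> c \<cdot>\<^sub>m (X * W) = X * P + Y"
proof -
  have "X * (c \<cdot>\<^sub>m W - P) = c \<cdot>\<^sub>m (X * W) - X * P"
    using assms by (simp add: mult_minus_distrib_mat[of _ n n _ n] mult_smult_distrib[of _ n n _ n])
  moreover have "c \<cdot>\<^sub>m (X * W) - X * P = Y \<longleftrightarrow> c \<cdot>\<^sub>m (X * W) = X * P + Y"
    using assms carrier_matD[OF assms(1)] carrier_matD[OF assms(2)] carrier_matD[OF assms(3)] carrier_matD[OF assms(4)]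
    by (simp add: mat_eq_iff diff_eq_eq add.commute del: index_mult_mat(1))
  ultimately show ?thesis by simp
qed

lemma L_equivalent_imp_flow:
  assumes A: "A \<in> carrier_mat m m" and B: "B \<in> carrier_mat m m"
    and V: "V \<in> carrier_mat m m" and W: "W \<in> carrier_mat m m"
    and equiv: "L_equivalent m A B V W"
  obtains \<eta> L K where "\<eta> > 0" "\<And>t. L t \<in> carrier_mat m m"
    "\<And>t. t > 0 \<Longrightarrow> has_mat_derivative_at m L (sylvester A V (L t)) t"
    "\<And>t. t > 0 \<Longrightarrow> norm_bound (L t) K" "\<And>t. t > 0 \<Longrightarrow> \<bar>det (L t)\<bar> > \<eta>"
    "\<And>t. t > 0 \<Longrightarrow> L t * (4 \<cdot>\<^sub>m W - V ^\<^sub>m 2) = (4 \<cdot>\<^sub>m B - A ^\<^sub>m 2) * L t"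
proof -
  note [simp] = A B V W
  note ac = square_mat_simps[where n = m]
  from equiv obtain F F' F'' where reg: "regular_mat_fun m F" and F: "has_mat_deriv m F F'" and F': "has_mat_deriv m F' F''"
    and eqV: "\<And>t. t \<ge> 0 \<Longrightarrow> V = mat_inv (F t) * (2 \<cdot>\<^sub>m F' t + A * F t)"
    and eqW: "\<And>t. t \<ge> 0 \<Longrightarrow> W = mat_inv (F t) * (F'' t + A * F' t + B * F t)"
    unfolding L_equivalent_def by auto
  from reg obtain \<eta> K where \<eta>: "\<eta> > 0" "\<And>t. t \<ge> 0 \<Longrightarrow> \<bar>det (F t)\<bar> > \<eta>" and K: "\<And>t. t \<ge> 0 \<Longrightarrow> norm_bound (F t) K"
    unfolding regular_mat_fun_def by auto
  \<comment> \<open>\<open>F\<close> is arbitrary at negative times; \<open>L\<close> agrees with it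
    on \<open>[0, \<infinity>)\<close> and is square everywhere.\<close>
  define L where "L s = mat m m (\<lambda>(i, j). F s $$ (i, j))" for s
  have Lc [simp]: "L s \<in> carrier_mat m m" for s by (simp add: L_def)
  have c: "F s \<in> carrier_mat m m" "F' s \<in> carrier_mat m m" "F'' s \<in> carrier_mat m m" if "s \<ge> 0" for s
    using F F' that by (auto simp: has_mat_deriv_def)
  have LF: "F s = L s" if "s \<ge> 0" for s
    using c(1)[OF that] by (auto simp: L_def)
  have undo: "L s * Z = Y" if "s \<ge> 0" "Z = mat_inv (F s) * Y" "Y \<in> carrier_mat m m" for s Y Z
  proof -
    have "det (L s) \<noteq> 0" using \<eta>(1) \<eta>(2)[OF that(1)] unfolding LF[OF that(1)] by auto
    then have "invertible_mat (L s)" by (simp add: invertible_mat_iff_det_nonzero[of _ m])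
    note inv = mat_inv[OF Lc this]
    have "L s * Z = (L s * mat_inv (L s)) * Y"
      unfolding that(2) LF[OF that(1)] using inv(1) that(3) by (simp add: ac)
    then show ?thesis using inv(2) that(3) by (simp add: ac)
  qed
  have F'_eq: "F' s = sylvester A V (L s)" if s: "s \<ge> 0" for s
  proof -
    note [simp] = c[OF s]
    have *: "L s * V = 2 \<cdot>\<^sub>m F' s + A * L s"
      using undo[OF s eqV[OF s]] unfolding LF[OF s] by (simp add: ac)
    show ?thesis
    proof (rule eq_matI)
      fix i j assume "i < dim_row (sylvester A V (L s))" "j < dim_col (sylvester A V (L s))"
      then have ij: "i < m" "j < m" using carrier_matD[OF sylvester_carrier[OF A V Lc[of s]]] by auto
      show "F' s $$ (i, j) = sylvester A V (L s) $$ (i, j)"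
        unfolding sylvester_index[OF A V Lc ij] *
        using ij carrier_matD[OF c(2)[OF s]] carrier_matD[OF A] carrier_matD[OF Lc[of s]] by (simp del: index_mult_mat(1))
    qed (use carrier_matD[OF sylvester_carrier[OF A V Lc[of s]]] carrier_matD[OF c(2)[OF s]] in auto)
  qed
  have dL: "has_mat_derivative_at m L (sylvester A V (L t)) t" if "t > 0" for t
    using has_mat_deriv_imp_at[OF F, of L t] F'_eq[of t] LF that by auto
  \<comment> \<open>\<open>F''\<close> comes from differentiating \<open>F' = \<Phi> L\<close>, an
    identity known only for nonnegative times, hence the comparison at \<open>t > 0\<close>.\<close>
  have F''_eq: "F'' t = sylvester A V (sylvester A V (L t))" if t: "t > 0" for t
  proof (rule has_mat_derivative_at_unique[OF _ has_mat_derivative_at_sylvester[OF dL[OF t] A V] _ t])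
    show "has_mat_derivative_at m (\<lambda>s. sylvester A V (L s)) (F'' t) t"
      by (rule has_mat_deriv_imp_at[OF F' _ _ t]) (use F'_eq in auto)
  qed simp
  show ?thesis
  proof (rule that[OF \<eta>(1) Lc dL])
    fix t :: real assume t: "t > 0"
    then have t0: "t \<ge> 0" by simp
    show "norm_bound (L t) K" "\<bar>det (L t)\<bar> > \<eta>"
      using K[OF t0] \<eta>(2)[OF t0] by (simp_all add: LF[OF t0])
    have "L t * W = F'' t + A * F' t + B * F t"
      by (rule undo[OF t0 eqW[OF t0]]) (use c[OF t0] in \<open>auto simp: ac\<close>)
    then have "4 \<cdot>\<^sub>m (L t * W) = L t * V ^\<^sub>m 2 + (4 \<cdot>\<^sub>m B - A ^\<^sub>m 2) * L t"
      unfolding F''_eq[OF t] F'_eq[OF t0] LF[OF t0] using sylvester_twice[OF A B V Lc] by simp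
    then show "L t * (4 \<cdot>\<^sub>m W - V ^\<^sub>m 2) = (4 \<cdot>\<^sub>m B - A ^\<^sub>m 2) * L t"
      by (subst mat_mult_minus_eq_iff[of _ m]) (auto simp: ac)
  qed
qed

subsection \<open>The characterization of \<open>L\<close>-equivalence\<close>

text \<open>Differentiating the relation at level \<open>k\<close> along the flow gives one side of
  \<open>sylvester_intertwines_iff\<close>; the other side is the relation at level
  \<open>k + 1\<close>.\<close>

lemma flow_intertwines_iterated_commutators:
  fixes L :: "real \<Rightarrow> real mat"
  assumes A: "A \<in> carrier_mat n n" and V: "V \<in> carrier_mat n n" and G: "G \<in> carrier_mat n n" and Q: "Q \<in> carrier_mat n n"
    and L: "\<And>t. t > 0 \<Longrightarrow> has_mat_derivative_at n L (sylvester A V (L t)) t"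
    and eq: "\<And>t. t > 0 \<Longrightarrow> L t * G = Q * L t" and t: "t > 0"
  shows "L t * iterated_commutator G (replicate k V) = iterated_commutator Q (replicate k A) * L t"
  using t
proof (induction k arbitrary: t)
  case 0
  then show ?case using eq by (simp add: iterated_commutator_def)
next
  case (Suc k)
  have Lc: "L t \<in> carrier_mat n n" using has_mat_derivative_at_carrierD(1)[OF L[OF Suc.prems]] .
  let ?G = "iterated_commutator G (replicate k V)" and ?Q = "iterated_commutator Q (replicate k A)"
  have c: "?G \<in> carrier_mat n n" "?Q \<in> carrier_mat n n" using A V G Q by auto
  have "sylvester A V (L t) * ?G = ?Q * sylvester A V (L t)"
    by (rule has_mat_derivative_at_unique[OF has_mat_derivative_at_mult_right[OF L[OF Suc.prems] c(1)]
          has_mat_derivative_at_mult_left[OF L[OF Suc.prems] c(2)] Suc.IH Suc.prems])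
  then show ?case
    unfolding iterated_commutator_replicate_Suc
    using sylvester_intertwines_iff[OF A V c Lc Suc.IH[OF Suc.prems]] by simp
qed

text \<open>The induction on \<open>r\<close> treats all \<open>k\<close> at once, since one more
  \<Phi> at level \<open>k\<close> uses the current iterate at levels \<open>k\<close> and
  \<open>k + 1\<close>. Level 0 says that all derivatives of \<open>L G - Q L\<close> vanish where
  the flow passes through \<open>C\<close>.\<close>

lemma sylvester_funpow_intertwines:
  fixes A V G Q C :: "'a :: field_char_0 mat"
  assumes A: "A \<in> carrier_mat n n" and V: "V \<in> carrier_mat n n" and G: "G \<in> carrier_mat n n" and Q: "Q \<in> carrier_mat n n"
    and C: "C \<in> carrier_mat n n"
    and eq: "\<And>k. C * iterated_commutator G (replicate k V) = iterated_commutator Q (replicate k A) * C"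
  shows "(sylvester A V ^^ r) C * iterated_commutator G (replicate k V) =
    iterated_commutator Q (replicate k A) * (sylvester A V ^^ r) C"
proof (induction r arbitrary: k)
  case (Suc r)
  have "(sylvester A V ^^ r) C * commutator (iterated_commutator G (replicate k V)) V =
    commutator (iterated_commutator Q (replicate k A)) A * (sylvester A V ^^ r) C"
    using Suc.IH[of "Suc k"] unfolding iterated_commutator_replicate_Suc .
  then show ?case
    using sylvester_intertwines_iff[OF A V _ _ _ Suc.IH[of k]] A V G Q C by simp
qed (simp add: eq)

text \<open>This turns an intertwining relation into the vanishing of finitely many linear
  functionals, the form required by \<open>sylvester_flow_flat\<close>.\<close>

lemma sylvester_eq_0_iff:
  fixes A V X :: "'a :: field_char_0 mat"
  assumes A: "A \<in> carrier_mat n n" and V: "V \<in> carrier_mat n n" and X: "X \<in> carrier_mat n n"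
  shows "X * V = A * X \<longleftrightarrow> (\<forall>i<n. \<forall>j<n. sylvester A V X $$ (i, j) = 0)"
  using carrier_matD[OF A] carrier_matD[OF V] carrier_matD[OF X]
  by (auto simp: sylvester_index[OF A V X] mat_eq_iff simp del: index_mult_mat(1))

lemma L_equivalent_of_flow:
  assumes A: "A \<in> carrier_mat m m" and B: "B \<in> carrier_mat m m"
    and V: "V \<in> carrier_mat m m" and W: "W \<in> carrier_mat m m"
    and L: "\<And>t. has_mat_derivative_at m L (sylvester A V (L t)) t"
    and K: "\<And>t. norm_bound (L t) K" and d: "d > 0" "\<And>t. \<bar>det (L t)\<bar> = d"
    and eq: "\<And>t. t \<ge> 0 \<Longrightarrow> L t * (4 \<cdot>\<^sub>m W - V ^\<^sub>m 2) = (4 \<cdot>\<^sub>m B - A ^\<^sub>m 2) * L t"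
  shows "L_equivalent m A B V W"
proof -
  note [simp] = A B V W
  note ac = square_mat_simps[where n = m]
  have Lc [simp]: "L t \<in> carrier_mat m m" for t using has_mat_derivative_at_carrierD(1)[OF L] .
  let ?L' = "\<lambda>t. sylvester A V (L t)"
  let ?L'' = "\<lambda>t. sylvester A V (?L' t)"
  have deriv: "has_mat_deriv m F F'" if "\<And>t. has_mat_derivative_at m F (F' t) t" for F F'
    using that unfolding has_mat_deriv_def has_mat_derivative_at_def
    by (auto intro: has_field_derivative_at_within simp flip: has_real_derivative_iff_has_vector_derivative)
  have dL: "has_mat_deriv m L ?L'" by (rule deriv[OF L])
  have dL': "has_mat_deriv m ?L' ?L''" by (rule deriv[OF has_mat_derivative_at_sylvester[OF L A V]])
  have cont: "continuous_on {0..} (\<lambda>t. ?L' t $$ (i, j))" if "i < m" "j < m" for i j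
    using dL' that by (auto simp: has_mat_deriv_def continuous_on_eq_continuous_within intro: DERIV_continuous)
  \<comment> \<open>Regularity asks for a strict lower bound of the determinant, so a constant below
    \<open>d\<close> is taken.\<close>
  have "\<exists>\<eta>>0. \<forall>t\<ge>0::real. \<eta> < d" using d(1) by (intro exI[of _ "d / 2"]) auto
  then have reg: "regular_mat_fun m L"
    unfolding regular_mat_fun_def d(2) using dL cont K by blast
  have solve: "mat_inv (L t) * (L t * Z) = Z" if "Z \<in> carrier_mat m m" for t Z
  proof -
    have "det (L t) \<noteq> 0" using d(1) d(2)[of t] by auto
    then have "invertible_mat (L t)" by (simp add: invertible_mat_iff_det_nonzero[of _ m])
    note inv = mat_inv[OF Lc this]
    have "mat_inv (L t) * (L t * Z) = (mat_inv (L t) * L t) * Z"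
      using inv(1) that by (simp add: ac)
    then show ?thesis using inv(3) that by (simp add: ac)
  qed
  have "V = mat_inv (L t) * (2 \<cdot>\<^sub>m ?L' t + A * L t)" for t
  proof -
    have "2 \<cdot>\<^sub>m ?L' t + A * L t = L t * V"
      unfolding sylvester_def
      using carrier_matD[OF A] carrier_matD[OF V] carrier_matD[OF Lc[of t]]
      by (intro eq_matI) (auto simp: field_simps simp del: index_mult_mat(1))
    then show ?thesis by (simp add: solve)
  qed
  moreover have "W = mat_inv (L t) * (?L'' t + A * ?L' t + B * L t)" if t: "t \<ge> 0" for t
  proof -
    have "4 \<cdot>\<^sub>m (?L'' t + A * ?L' t + B * L t) = L t * V ^\<^sub>m 2 + (4 \<cdot>\<^sub>m B - A ^\<^sub>m 2) * L t"
      by (rule sylvester_twice[OF A B V Lc])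
    also have "\<dots> = 4 \<cdot>\<^sub>m (L t * W)"
      using eq[OF t] by (subst (asm) mat_mult_minus_eq_iff[of _ m]) (auto simp: ac)
    finally have "?L'' t + A * ?L' t + B * L t = L t * W"
      by (subst (asm) smult_mat_cancel) auto
    then show ?thesis by (simp add: solve)
  qed
  ultimately show ?thesis unfolding L_equivalent_def using reg dL dL' by blast
qed

theorem theorem6:
  fixes m :: nat and A B V W :: "real mat"
  assumes "0 < m"
    and "A \<in> carrier_mat m m" and "B \<in> carrier_mat m m"
    and "V \<in> carrier_mat m m" and "W \<in> carrier_mat m m"
  shows "L_equivalent m A B V W \<longleftrightarrow>
    (\<exists>C \<in> carrier_mat m m. invertible_mat C \<and>
       real_part_mat V = mat_inv C * real_part_mat A * C \<and>
       4 \<cdot>\<^sub>m W = V ^\<^sub>m 2 + mat_inv C * (4 \<cdot>\<^sub>m B - A ^\<^sub>m 2) * C \<and>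
       (\<forall>n \<in> {0..m\<^sup>2 - 1}.
          iterated_commutator (4 \<cdot>\<^sub>m B - A ^\<^sub>m 2) (replicate n A @ [C * V * mat_inv C - A])
            = 0\<^sub>m m m))"
proof -
  note A [simp] = assms(2) and B [simp] = assms(3) and V [simp] = assms(4) and W [simp] = assms(5)
  note ac = square_mat_simps[where n = m]
  define G where "G = 4 \<cdot>\<^sub>m W - V ^\<^sub>m 2"
  define Q where "Q = 4 \<cdot>\<^sub>m B - A ^\<^sub>m 2"
  have G [simp]: "G \<in> carrier_mat m m" by (simp add: G_def ac pow_carrier_mat)
  have Q [simp]: "Q \<in> carrier_mat m m" by (simp add: Q_def ac pow_carrier_mat)
  let ?G = "\<lambda>k. iterated_commutator G (replicate k V)" and ?Q = "\<lambda>k. iterated_commutator Q (replicate k A)"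
  have RA [simp]: "real_part_mat A \<in> carrier_mat m m" using real_part_mat_bidiagE[OF A] by blast
  have RV [simp]: "real_part_mat V \<in> carrier_mat m m" using real_part_mat_bidiagE[OF V] by blast
  have inverse_conj: "X = mat_inv C * Y * C \<longleftrightarrow> C * X = Y * C"
    if [simp]: "C \<in> carrier_mat m m" "X \<in> carrier_mat m m" "Y \<in> carrier_mat m m" and inv: "invertible_mat C"
    for C X Y :: "real mat"
  proof -
    note I = mat_inv[OF that(1) inv]
    note [simp] = I(1)
    have "C * (mat_inv C * Y * C) = (C * mat_inv C) * (Y * C)" by (simp add: ac)
    then have 1: "C * (mat_inv C * Y * C) = Y * C" unfolding I(2) by (simp add: ac)
    have "mat_inv C * (C * X) = (mat_inv C * C) * X" by (simp add: ac)
    then have 2: "mat_inv C * (C * X) = X" unfolding I(3) by (simp add: ac)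
    have 3: "mat_inv C * (Y * C) = mat_inv C * Y * C" by (simp add: ac)
    show ?thesis using 1 2 3 by metis
  qed
  have W_eq: "4 \<cdot>\<^sub>m W = V ^\<^sub>m 2 + Z \<longleftrightarrow> G = Z" if "Z \<in> carrier_mat m m" for Z
    unfolding G_def using carrier_matD[OF that] carrier_matD[OF V] carrier_matD[OF W] carrier_matD[OF pow_carrier_mat[OF V, of 2]]
    by (auto simp: mat_eq_iff diff_eq_eq add.commute)
  have W_iff: "4 \<cdot>\<^sub>m W = V ^\<^sub>m 2 + mat_inv C * Q * C \<longleftrightarrow> C * G = Q * C"
    if C: "C \<in> carrier_mat m m" and inv: "invertible_mat C" for C
  proof -
    have "mat_inv C * Q * C \<in> carrier_mat m m" using mat_inv(1)[OF that] C by (simp add: ac)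
    from W_eq[OF this] inverse_conj[OF C G Q inv] show ?thesis by simp
  qed
  show ?thesis
    unfolding Q_def[symmetric]
  proof
    assume equiv: "L_equivalent m A B V W"
    obtain \<eta> L K where \<eta>: "\<eta> > 0" and Lc: "\<And>t. L t \<in> carrier_mat m m"
      and L: "\<And>t. t > 0 \<Longrightarrow> has_mat_derivative_at m L (sylvester A V (L t)) t"
      and K: "\<And>t. t > 0 \<Longrightarrow> norm_bound (L t) K" and det: "\<And>t. t > 0 \<Longrightarrow> \<bar>det (L t)\<bar> > \<eta>"
      and LG': "\<And>t. t > 0 \<Longrightarrow> L t * (4 \<cdot>\<^sub>m W - V ^\<^sub>m 2) = (4 \<cdot>\<^sub>m B - A ^\<^sub>m 2) * L t"
      using L_equivalent_imp_flow[OF A B V W equiv] by blast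
    note LG = LG'[folded G_def Q_def]
    obtain C \<tau> where C [simp]: "C \<in> carrier_mat m m"
      and \<tau>: "filterlim \<tau> at_top sequentially" "\<And>k :: nat. \<tau> k > 0"
      and lim: "\<And>i j. i < m \<Longrightarrow> j < m \<Longrightarrow> (\<lambda>k. L (\<tau> k) $$ (i, j)) \<longlonglongrightarrow> C $$ (i, j)"
      using bounded_flow_limit_point[of L m K, OF Lc K] by blast
    have "(\<lambda>k. det (L (\<tau> k))) \<longlonglongrightarrow> det C" by (rule tendsto_det[OF Lc C lim])
    \<comment> \<open>The uniform lower bound on the determinant survives in the limit and makes
      \<open>C\<close> invertible.\<close>
    then have "\<eta> \<le> \<bar>det C\<bar>"
      using det[OF \<tau>(2)] by (intro tendsto_lowerbound[OF tendsto_rabs]) (auto intro!: always_eventually less_imp_le)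
    with \<eta> have inv: "invertible_mat C" by (auto simp: invertible_mat_iff_det_nonzero[OF C])
    \<comment> \<open>The asymptotic relation along the flow becomes exact at the limit
      point.\<close>
    have "real_part_mat A * C = C * real_part_mat V"
    proof (rule limit_intertwines[OF Lc C RA RV trivial_limit_sequentially lim])
      fix i j assume "i < m" "j < m"
      from filterlim_compose[OF bounded_sylvester_flow_asymptotic[OF A V L K this] \<tau>(1)]
      show "(\<lambda>k. (real_part_mat A * L (\<tau> k) - L (\<tau> k) * real_part_mat V) $$ (i, j)) \<longlonglongrightarrow> 0" .
    qed
    then have 1: "real_part_mat V = mat_inv C * real_part_mat A * C"
      using inverse_conj[OF C RV RA inv] by simp
    \<comment> \<open>These relations hold at every positive time along the flow, so they pass to
      the limit for all \<open>k\<close>.\<close>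
    have CG: "C * ?G k = ?Q k * C" for k
    proof (rule limit_intertwines[OF Lc C _ _ trivial_limit_sequentially lim, symmetric])
      fix i j assume ij: "i < m" "j < m"
      have "?Q k * L (\<tau> r) - L (\<tau> r) * ?G k = 0\<^sub>m m m" for r
      proof -
        have "L (\<tau> r) * ?G k = ?Q k * L (\<tau> r)"
          by (rule flow_intertwines_iterated_commutators[OF A V G Q L LG \<tau>(2)])
        moreover have "?Q k * L (\<tau> r) \<in> carrier_mat m m"
          using Lc[of "\<tau> r"] by (simp add: ac)
        ultimately show ?thesis by (simp add: minus_r_inv_mat)
      qed
      then show "(\<lambda>r. (?Q k * L (\<tau> r) - L (\<tau> r) * ?G k) $$ (i, j)) \<longlonglongrightarrow> 0"
        using ij by simp
    qed auto
    have 2: "4 \<cdot>\<^sub>m W = V ^\<^sub>m 2 + mat_inv C * Q * C"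
      using W_iff[OF C inv] CG[of 0] by (simp add: iterated_commutator_def)
    have "iterated_commutator Q (replicate k A @ [C * V * mat_inv C - A]) = 0\<^sub>m m m" for k
      unfolding iterated_commutator_snoc
      using commutator_conjugate_iff[OF A C _ _ V inv CG[of k]] CG[of "Suc k"]
      unfolding iterated_commutator_replicate_Suc by simp
    with inv 1 2 show "\<exists>C \<in> carrier_mat m m. invertible_mat C \<and>
       real_part_mat V = mat_inv C * real_part_mat A * C \<and>
       4 \<cdot>\<^sub>m W = V ^\<^sub>m 2 + mat_inv C * Q * C \<and>
       (\<forall>n \<in> {0..m\<^sup>2 - 1}. iterated_commutator Q (replicate n A @ [C * V * mat_inv C - A]) = 0\<^sub>m m m)"
      using C by blast
  next
    assume "\<exists>C \<in> carrier_mat m m. invertible_mat C \<and>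
       real_part_mat V = mat_inv C * real_part_mat A * C \<and>
       4 \<cdot>\<^sub>m W = V ^\<^sub>m 2 + mat_inv C * Q * C \<and>
       (\<forall>n \<in> {0..m\<^sup>2 - 1}. iterated_commutator Q (replicate n A @ [C * V * mat_inv C - A]) = 0\<^sub>m m m)"
    then obtain C where C [simp]: "C \<in> carrier_mat m m" and inv: "invertible_mat C"
      and 1: "real_part_mat V = mat_inv C * real_part_mat A * C"
      and 2: "4 \<cdot>\<^sub>m W = V ^\<^sub>m 2 + mat_inv C * Q * C"
      and 3: "\<And>n. n \<in> {0..m\<^sup>2 - 1} \<Longrightarrow> iterated_commutator Q (replicate n A @ [C * V * mat_inv C - A]) = 0\<^sub>m m m"
      by blast
    have P: "C * V * mat_inv C - A \<in> carrier_mat m m" by (intro minus_carrier_mat A)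
    \<comment> \<open>As \<open>m > 0\<close>, the assumption covers exactly the indices below
      \<open>m\<^sup>2\<close>; the linear recurrence extends it to all \<open>k\<close>.\<close>
    have vanish: "commutator (?Q k) (C * V * mat_inv C - A) = 0\<^sub>m m m" for k
      unfolding iterated_commutator_snoc[symmetric]
      by (rule iterated_commutators_vanish[OF Q A P 3]) auto
    \<comment> \<open>The equation for \<open>W\<close> is level 0, and each vanishing commutator
      raises the level by one.\<close>
    have CG: "C * ?G k = ?Q k * C" for k
    proof (induction k)
      case 0
      show ?case using W_iff[OF C inv] 2 by (simp add: iterated_commutator_def)
    next
      case (Suc k)
      show ?case
        using commutator_conjugate_iff[OF A C _ _ V inv Suc] vanish[of k]
        unfolding iterated_commutator_replicate_Suc by simp
    qed
    have RC: "real_part_mat A * C = C * real_part_mat V"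
      using inverse_conj[OF C RV RA inv] 1 by simp
    obtain L K where L0: "L 0 = C"
      and L: "\<And>t. has_mat_derivative_at m L (sylvester A V (L t)) t"
      and K: "\<And>t. norm_bound (L t) K" and det: "\<And>t. \<bar>det (L t)\<bar> = \<bar>det C\<bar>"
      using bounded_sylvester_flow_exists[OF A V C RC] by blast
    have Lc [simp]: "L t \<in> carrier_mat m m" for t using has_mat_derivative_at_carrierD(1)[OF L] .
    \<comment> \<open>The relation is tested entrywise: each entry of \<open>sylvester Q G\<close>
      is a bounded linear functional, and \<open>CG\<close> makes it vanish on all iterates of
      \<Phi> at \<open>C\<close>.\<close>
    have LG: "L t * G = Q * L t" for t
      unfolding sylvester_eq_0_iff[OF Q G Lc]
    proof (intro allI impI)
      fix i j assume ij: "i < m" "j < m"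
      obtain c where c: "\<And>X b. X \<in> carrier_mat m m \<Longrightarrow> norm_bound X b \<Longrightarrow> norm_bound (sylvester Q G X) (b * c)"
        using norm_bound_sylvester[OF Q G] by blast
      show "sylvester Q G (L t) $$ (i, j) = 0"
      proof (rule sylvester_flow_flat[OF A V L K, of "\<lambda>X. sylvester Q G X $$ (i, j)" c])
        show "((\<lambda>s. sylvester Q G (F s) $$ (i, j)) has_real_derivative sylvester Q G F' $$ (i, j)) (at r)"
          if "has_mat_derivative_at m F F' r" for F F' r
          using has_mat_derivative_at_sylvester[OF that Q G] ij
          by (auto simp: has_mat_derivative_at_def has_real_derivative_iff_has_vector_derivative)
        show "\<bar>sylvester Q G X $$ (i, j)\<bar> \<le> b * c" if "X \<in> carrier_mat m m" "norm_bound X b" for X b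
          using c[OF that] ij carrier_matD[OF sylvester_carrier[OF Q G that(1)]] by (auto simp: norm_bound_def)
        show "sylvester Q G ((sylvester A V ^^ k) (L 0)) $$ (i, j) = 0" for k
        proof -
          have "(sylvester A V ^^ k) C * G = Q * (sylvester A V ^^ k) C"
            using sylvester_funpow_intertwines[OF A V G Q C CG, of k 0] by (simp add: iterated_commutator_def)
          then show ?thesis
            using sylvester_eq_0_iff[OF Q G funpow_sylvester_carrier[OF A V C]] ij L0 by simp
        qed
      qed
    qed
    show "L_equivalent m A B V W"
    proof (rule L_equivalent_of_flow[OF A B V W L K _ det])
      show "\<bar>det C\<bar> > 0" using inv by (simp add: invertible_mat_iff_det_nonzero[OF C])
    qed (use LG in \<open>simp add: G_def Q_def\<close>)
  qed
qed

end
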